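(* Let $L$ denote either $L_{\mathrm{edge}}$ or $L_{\mathrm{trc}}$, and let $\phi:H_1(\Sigma;\mathbb Z)\to L^\vee$, $h\mapsto\langle h,\cdot\rangle|_L$. Then the induced map $\phi_*:\mathrm{Hom}_{\mathbb Z\mathcal I}(V_o,H_1(\Sigma;\mathbb Z))\to\mathrm{Hom}_{\mathbb Z\mathcal I}(V_o,L^\vee)$ is surjective, so that $$0\to\mathrm{Hom}_{\mathbb Z\mathcal I}(V_o,L)\to\mathrm{Hom}_{\mathbb Z\mathcal I}(V_o,H_1(\Sigma;\mathbb Z))\to\mathrm{Hom}_{\mathbb Z\mathcal I}(V_o,L^\vee)\to0$$ is exact.
   Context: $D$ regular dodecahedron centered at $0$, $\mathcal I\subset\mathrm{SO}(3)$ its rotation group, $\iota=-\mathrm{id}$, $\mathcal K$ the five inscribed cubes, $V_o=\mathbb Z^{\mathcal K}/\mathbb Z(\sum e)$. $\Sigma$: the closed genus-10 surface obtained from the surface $D$ by removing an $\mathcal I$- and $\iota$-invariant small open triangle around each vertex and identifying antipodal boundary points. $\delta_x$ (vertex $x$) is the counterclockwise boundary of the removed triangle at $x$; $\delta_y$ (oriented edge $y$) is the loop formed by edge-type cells $y$ and $\iota y$. $L_{\mathrm{trc}}\subset H_1(\Sigma;\mathbb Z)$ is the sublattice spanned by the classes $[\delta_x]$ and $L_{\mathrm{edge}}$ the one spanned by the $[\delta_y]$; each is a primitive Lagrangian sublattice (the kernel of $H_1(\Sigma)\to H_1(\Sigma_{\mathrm{trc}})$ resp. $H_1(\Sigma_{\mathrm{edge}})$,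 where $\Sigma_{\mathrm{trc}},\Sigma_{\mathrm{edge}}$ are obtained by contracting the respective loops), so the intersection pairing $\langle\,,\rangle$ induces a short exact sequence $0\to L\to H_1(\Sigma)\xrightarrow{\phi}L^\vee\to0$. *)

theory Defs
  imports "HOL-Analysis.Analysis"
begin

definition gold :: real where "gold = (1 + sqrt 5) / 2"

definition Vert :: "(real^3) set" where
  "Vert =
     {vector [s1, s2, s3] | s1 s2 s3. s1 \<in> {-1,1} \<and> s2 \<in> {-1,1} \<and> s3 \<in> {-1,1}}
   \<union> {vector [0, s / gold, t * gold] | s t. s \<in> {-1,1} \<and> t \<in> {-1,1}}
   \<union> {vector [s / gold, t * gold, 0] | s t. s \<in> {-1,1} \<and> t \<in> {-1,1}}
   \<union> {vector [s * gold, 0, t / gold] | s t. s \<in> {-1,1} \<and> t \<in> {-1,1}}"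

definition dadj :: "real^3 \<Rightarrow> real^3 \<Rightarrow> bool" where
  "dadj x y \<longleftrightarrow> x \<in> Vert \<and> y \<in> Vert \<and> x \<noteq> y \<and>
     (\<forall>z\<in>Vert. \<forall>w\<in>Vert. z \<noteq> w \<longrightarrow> dist x y \<le> dist z w)"

definition dfaces :: "(real^3) set set" where
  "dfaces = {Vert \<inter> F | F. F face_of convex hull Vert \<and> aff_dim F = 2}"

definition Igrp :: "(real^3^3) set" where
  "Igrp = {g. rotation_matrix g \<and> (\<lambda>v. g *v v) ` Vert = Vert}"

definition is_cube :: "(real^3) set \<Rightarrow> bool" where
  "is_cube S \<longleftrightarrow> (\<exists>c u v w. u \<bullet> v = 0 \<and> v \<bullet> w = 0 \<and> u \<bullet> w = 0 \<and> u \<noteq> 0 \<and>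
       norm u = norm v \<and> norm v = norm w \<and>
       S = {c + s1 *\<^sub>R u + s2 *\<^sub>R v + s3 *\<^sub>R w | s1 s2 s3.
              s1 \<in> {-1,1} \<and> s2 \<in> {-1,1} \<and> s3 \<in> {-1,1}})"

definition Cubes :: "(real^3) set set" where
  "Cubes = {S. S \<subseteq> Vert \<and> is_cube S}"

definition act_cube :: "real^3^3 \<Rightarrow> (real^3) set \<Rightarrow> (real^3) set" where
  "act_cube g S = (\<lambda>v. g *v v) ` S"

text \<open>Counterclockwise (seen from outside) order of neighbours a, b around the vertex x.\<close>
definition ccw :: "real^3 \<Rightarrow> real^3 \<Rightarrow> real^3 \<Rightarrow> bool" where
  "ccw x a b \<longleftrightarrow> (cross3 (a - x) (b - x)) \<bullet> x > 0"

text \<open>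
  X0 = D minus the 20 small open triangles.  0-cells: for an oriented edge (x,a) the point
  on the edge xa on the boundary of the triangle at x.  Oriented 1-cells:
  \<open>Ed x a\<close> = the remaining part of the edge xa, from the point (x,a) to the point (a,x);
  \<open>Ar x a b\<close> = the side of the removed triangle at x from the point (x,a) to the point (x,b).
  2-cells: the 12 truncated faces, oriented by the outward normal.
  Sigma = X0 / (antipodal identification of the triangle boundaries), whose cellular chain
  complex is C(X0) modulo the span of (cell - antipodal cell) for boundary cells.
\<close>

datatype cell1 = Ed "real^3" "real^3" | Ar "real^3" "real^3" "real^3"

definition cells1 :: "cell1 set" where
  "cells1 = {Ed x a | x a. dadj x a} \<union> {Ar x a b | x a b. dadj x a \<and> dadj x b \<and> a \<noteq> b}"

definition arcs1 :: "cell1 set" where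
  "arcs1 = {Ar x a b | x a b. dadj x a \<and> dadj x b \<and> a \<noteq> b}"

fun rev1 :: "cell1 \<Rightarrow> cell1" where
  "rev1 (Ed x a) = Ed a x"
| "rev1 (Ar x a b) = Ar x b a"

fun antip1 :: "cell1 \<Rightarrow> cell1" where
  "antip1 (Ed x a) = Ed (- x) (- a)"
| "antip1 (Ar x a b) = Ar (- x) (- a) (- b)"

fun tgt1 :: "cell1 \<Rightarrow> (real^3) \<times> (real^3)" where
  "tgt1 (Ed x a) = (a, x)"
| "tgt1 (Ar x a b) = (x, b)"

fun act_cell :: "real^3^3 \<Rightarrow> cell1 \<Rightarrow> cell1" where
  "act_cell g (Ed x a) = Ed (g *v x) (g *v a)"
| "act_cell g (Ar x a b) = Ar (g *v x) (g *v a) (g *v b)"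

definition chain1 :: "(cell1 \<Rightarrow> int) \<Rightarrow> bool" where
  "chain1 c \<longleftrightarrow> (\<forall>\<sigma>. \<sigma> \<notin> cells1 \<longrightarrow> c \<sigma> = 0) \<and> (\<forall>\<sigma>. c (rev1 \<sigma>) = - c \<sigma>)"

definition bd1 :: "(cell1 \<Rightarrow> int) \<Rightarrow> (real^3) \<times> (real^3) \<Rightarrow> int" where
  "bd1 c q = (\<Sum>\<sigma>\<in>{\<sigma>\<in>cells1. tgt1 \<sigma> = q}. c \<sigma>)"

text \<open>1-cycles of Sigma (boundary lies in the span of (p - antipodal p)).\<close>
definition sigma_cycle :: "(cell1 \<Rightarrow> int) \<Rightarrow> bool" where
  "sigma_cycle c \<longleftrightarrow> chain1 c \<and> (\<forall>x a. dadj x a \<longrightarrow> bd1 c (x, a) + bd1 c (- x, - a) = 0)"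

definition centroid :: "(real^3) set \<Rightarrow> real^3" where
  "centroid S = (1 / real (card S)) *\<^sub>R (\<Sum>v\<in>S. v)"

text \<open>Oriented edge a -> b on the counterclockwise boundary of the face S.\<close>
definition fedge :: "(real^3) set \<Rightarrow> real^3 \<Rightarrow> real^3 \<Rightarrow> bool" where
  "fedge S a b \<longleftrightarrow> a \<in> S \<and> b \<in> S \<and> dadj a b \<and>
     (cross3 (a - centroid S) (b - centroid S)) \<bullet> centroid S > 0"

fun face_bd :: "(real^3) set \<Rightarrow> cell1 \<Rightarrow> int" where
  "face_bd S (Ed a b) = (if fedge S a b then 1 else if fedge S b a then -1 else 0)"
| "face_bd S (Ar b a c) =
     (if fedge S a b \<and> fedge S b c then 1 else if fedge S c b \<and> fedge S b a then -1 else 0)"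

text \<open>c is null-homologous in Sigma: c lies in the image of the face boundaries plus the
  span of (arc - antipodal arc).\<close>
definition sigma_null :: "(cell1 \<Rightarrow> int) \<Rightarrow> bool" where
  "sigma_null c \<longleftrightarrow> (\<exists>n :: (real^3) set \<Rightarrow> int.
     let r = (\<lambda>\<sigma>. c \<sigma> - (\<Sum>S\<in>dfaces. n S * face_bd S \<sigma>)) in
       (\<forall>x a. dadj x a \<longrightarrow> r (Ed x a) = 0) \<and> (\<forall>\<sigma>\<in>arcs1. r \<sigma> + r (antip1 \<sigma>) = 0))"

definition act_chain :: "real^3^3 \<Rightarrow> (cell1 \<Rightarrow> int) \<Rightarrow> cell1 \<Rightarrow> int" where
  "act_chain g c = (\<lambda>\<sigma>. c (act_cell (matrix_inv g) \<sigma>))"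

fun delta_trc :: "real^3 \<Rightarrow> cell1 \<Rightarrow> int" where
  "delta_trc x (Ar x' a b) =
     (if x' = x \<and> dadj x a \<and> dadj x b \<and> a \<noteq> b then (if ccw x a b then 1 else -1) else 0)"
| "delta_trc x (Ed _ _) = 0"

text \<open>delta_y for the oriented edge y = (a,b): the loop y followed by the reverse of iota y.\<close>
definition delta_edge :: "(real^3) \<times> (real^3) \<Rightarrow> cell1 \<Rightarrow> int" where
  "delta_edge y \<sigma> = (case y of (a, b) \<Rightarrow>
      (if \<sigma> = Ed a b then 1 else 0) - (if \<sigma> = Ed b a then 1 else 0)
    - (if \<sigma> = Ed (- a) (- b) then 1 else 0) + (if \<sigma> = Ed (- b) (- a) then 1 else 0))"

definition oedges :: "((real^3) \<times> (real^3)) set" where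
  "oedges = {(a, b). dadj a b}"

text \<open>Intersection number <h, delta_x> of a 1-cycle h of Sigma with delta_x
  (computed by pushing delta_x off the triangle boundary into the faces at x).\<close>
definition int_trc :: "(cell1 \<Rightarrow> int) \<Rightarrow> real^3 \<Rightarrow> int" where
  "int_trc h x = (\<Sum>a\<in>{a. dadj x a}. h (Ed x a))"

text \<open>Intersection number <h, delta_y>, y = (a,b) (computed by pushing delta_y off to its left;
  the push-off crosses the identified triangle boundaries once near a and once near b).\<close>
definition int_edge :: "(cell1 \<Rightarrow> int) \<Rightarrow> (real^3) \<times> (real^3) \<Rightarrow> int" where
  "int_edge h y = (case y of (a, b) \<Rightarrow>
      (\<Sum>d\<in>{d. dadj a d \<and> d \<noteq> b \<and> ccw a b d}. h (Ar a d b) + h (antip1 (Ar a d b)))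
    - (\<Sum>c\<in>{c. dadj b c \<and> c \<noteq> a \<and> ccw b c a}. h (Ar b a c) + h (antip1 (Ar b a c))))"

text \<open>A ZI-homomorphism V_o = Z^K / Z(sum e) \<rightarrow> H_1(Sigma) is given by the images u k
  (k a cube) of the basis vectors: 1-cycles, with sum null-homologous and
  u (g k) homologous to g (u k).\<close>
definition hom_VH :: "((real^3) set \<Rightarrow> cell1 \<Rightarrow> int) \<Rightarrow> bool" where
  "hom_VH u \<longleftrightarrow>
     (\<forall>k\<in>Cubes. sigma_cycle (u k)) \<and>
     sigma_null (\<lambda>\<sigma>. \<Sum>k\<in>Cubes. u k \<sigma>) \<and>
     (\<forall>g\<in>Igrp. \<forall>k\<in>Cubes. sigma_null (\<lambda>\<sigma>. u (act_cube g k) \<sigma> - act_chain g (u k) \<sigma>))"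

text \<open>An element of L^dual = Hom(L, Z), L spanned by the classes of delta i (i \<in> Idx),
  given by its values f i on the generators (respecting all relations in H_1).\<close>
definition is_Ldual :: "'i set \<Rightarrow> ('i \<Rightarrow> cell1 \<Rightarrow> int) \<Rightarrow> ('i \<Rightarrow> int) \<Rightarrow> bool" where
  "is_Ldual Idx \<delta> f \<longleftrightarrow>
     (\<forall>m :: 'i \<Rightarrow> int. sigma_null (\<lambda>\<sigma>. \<Sum>i\<in>Idx. m i * \<delta> i \<sigma>) \<longrightarrow> (\<Sum>i\<in>Idx. m i * f i) = 0)"

text \<open>A ZI-homomorphism V_o \<rightarrow> L^dual (I acting on L via g delta_i = delta_(g i)).\<close>
definition hom_VLd ::
  "'i set \<Rightarrow> ('i \<Rightarrow> cell1 \<Rightarrow> int) \<Rightarrow> (real^3^3 \<Rightarrow> 'i \<Rightarrow> 'i) \<Rightarrow> ((real^3) set \<Rightarrow> 'i \<Rightarrow> int) \<Rightarrow> bool"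
  where
  "hom_VLd Idx \<delta> actI F \<longleftrightarrow>
     (\<forall>k\<in>Cubes. is_Ldual Idx \<delta> (F k)) \<and>
     (\<forall>i\<in>Idx. (\<Sum>k\<in>Cubes. F k i) = 0) \<and>
     (\<forall>g\<in>Igrp. \<forall>k\<in>Cubes. \<forall>i\<in>Idx. F (act_cube g k) (actI g i) = F k i)"

definition phi_star_surj ::
  "'i set \<Rightarrow> ('i \<Rightarrow> cell1 \<Rightarrow> int) \<Rightarrow> (real^3^3 \<Rightarrow> 'i \<Rightarrow> 'i) \<Rightarrow> ((cell1 \<Rightarrow> int) \<Rightarrow> 'i \<Rightarrow> int) \<Rightarrow> bool"
  where
  "phi_star_surj Idx \<delta> actI pairing \<longleftrightarrow>
     (\<forall>F. hom_VLd Idx \<delta> actI F \<longrightarrow>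
        (\<exists>u. hom_VH u \<and> (\<forall>k\<in>Cubes. \<forall>i\<in>Idx. pairing (u k) i = F k i)))"

end

theory Submission
  imports Defs
begin

text \<open>
  A 1-cycle of the surface is null-homologous as soon as its intersection numbers with all
  \<open>\<delta>\<^sub>x\<close> and all \<open>\<delta>\<^sub>y\<close> vanish: the first condition makes its edge part a combination of
  face boundaries, and what then remains is a multiple \<open>t\<^sub>x\<close> of each triangle boundary, where
  the second condition gives \<open>t\<^sub>a = t\<^sub>b\<close> along edges while the antipodal identification gives
  \<open>t\<^bsub>-x\<^esub> = - t\<^sub>x\<close>. So a family of cycles indexed by the cubes defines a homomorphism into homology
  as soon as its intersection numbers are equivariant and sum to zero; the chains themselves need
  not be equivariant.

  On the other side, a homomorphism to either dual lattice is determined by its values at the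
  standard cube, and the rotations preserving that cube force these to be an integer multiple of
  \<open>T(x) = x\<^sub>1x\<^sub>2x\<^sub>3\<close> on vertices (zero off the cube), respectively of \<open>T(a) - T(b)\<close> on oriented
  edges \<open>(a,b)\<close>. Both functions are realised by cycles that pair to zero with the other
  lattice: a union of edge paths joining the vertices with \<open>T = 1\<close> to those with \<open>T = -1\<close>, and
  the negative sum of the \<open>\<delta>\<^sub>x\<close> with \<open>T(x) = 1\<close>.
\<close>

subsection \<open>Exact arithmetic in the golden ring\<close>

text \<open>The pair \<open>(a, b)\<close> stands for \<open>a + b\<phi>\<close>, so statements about the dodecahedron become
  finite integer computations.\<close>
type_synonym zphi = "int \<times> int"
type_synonym zvec = "zphi \<times> zphi \<times> zphi"

fun zadd :: "zphi \<Rightarrow> zphi \<Rightarrow> zphi" where "zadd (a, b) (c, d) = (a + c, b + d)"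
fun zsub :: "zphi \<Rightarrow> zphi \<Rightarrow> zphi" where "zsub (a, b) (c, d) = (a - c, b - d)"
fun zmul :: "zphi \<Rightarrow> zphi \<Rightarrow> zphi" where
  "zmul (a, b) (c, d) = (a * c + b * d, a * d + b * c + b * d)"
text \<open>Twice a + b phi equals s + b sqrt 5 with s = 2a + b. When s and b have opposite signs,
  s^2 is compared with 5 b^2, so integers alone decide positivity.\<close>

fun zpos :: "zphi \<Rightarrow> bool" where
  "zpos (a, b) \<longleftrightarrow>
     (let s = 2 * a + b in
      if b \<ge> 0 then (if s \<ge> 0 then s > 0 \<or> b > 0 else s * s < 5 * b * b)
      else s > 0 \<and> 5 * b * b < s * s)"
fun zdot :: "zvec \<Rightarrow> zvec \<Rightarrow> zphi" where
  "zdot (x, y, z) (x', y', z') = zadd (zmul x x') (zadd (zmul y y') (zmul z z'))"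
fun zcross :: "zvec \<Rightarrow> zvec \<Rightarrow> zvec" where
  "zcross (x, y, z) (x', y', z') =
     (zsub (zmul y z') (zmul z y'), zsub (zmul z x') (zmul x z'), zsub (zmul x y') (zmul y x'))"
definition zdet :: "zvec \<Rightarrow> zvec \<Rightarrow> zvec \<Rightarrow> zphi" where
  "zdet p q r = zdot (zcross p q) r"
fun zscale :: "zphi \<Rightarrow> zvec \<Rightarrow> zvec" where
  "zscale c (x, y, z) = (zmul c x, zmul c y, zmul c z)"
fun zvadd :: "zvec \<Rightarrow> zvec \<Rightarrow> zvec" where
  "zvadd (x, y, z) (x', y', z') = (zadd x x', zadd y y', zadd z z')"

lemmas zeval = zadd.simps zsub.simps zmul.simps zpos.simps zdot.simps zcross.simps zscale.simps
  zvadd.simps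

declare zeval [simp del]

definition zv :: "zphi \<Rightarrow> real" where
  "zv x = of_int (fst x) + of_int (snd x) * gold"

definition ev :: "zvec \<Rightarrow> real^3" where
  "ev p = vector [zv (fst p), zv (fst (snd p)), zv (snd (snd p))]"

lemma gold_sq: "gold * gold = gold + 1"
  by (simp add: gold_def field_simps)

lemma gold_pos: "gold > 0"
  by (simp add: gold_def add_pos_nonneg)

lemma inverse_gold: "1 / gold = gold - 1"
  using gold_sq gold_pos by (simp add: field_simps)

lemma zv_simps:
  "zv (zadd x y) = zv x + zv y" "zv (zsub x y) = zv x - zv y" "zv (zmul x y) = zv x * zv y"
proof -
  show "zv (zadd x y) = zv x + zv y" "zv (zsub x y) = zv x - zv y"
    by (cases x; cases y; simp add: zv_def zeval algebra_simps)+
  obtain a b c d where [simp]: "x = (a, b)" "y = (c, d)" by (cases x; cases y)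
  have "zv x * zv y = of_int a * of_int c + (of_int a * of_int d + of_int b * of_int c) * gold
          + of_int b * of_int d * (gold * gold)"
    by (simp add: zv_def zeval algebra_simps)
  then show "zv (zmul x y) = zv x * zv y"
    unfolding gold_sq by (simp add: zv_def zeval algebra_simps)
qed

lemma zpos_iff: "zpos x \<longleftrightarrow> zv x > 0"
proof -
  obtain a b where x: "x = (a, b)" by (cases x)
  define s where "s = 2 * a + b"
  define t where "t = \<bar>of_int b\<bar> * sqrt 5"
  have t0: "t \<ge> 0" and t2: "t\<^sup>2 = of_int (5 * b * b)"
    by (simp_all add: t_def power_mult_distrib) (simp add: power2_eq_square)
  have zv: "2 * zv x = of_int s + of_int b * sqrt 5"
    by (simp add: x zv_def s_def gold_def field_simps)
  have s2: "(of_int s :: real)\<^sup>2 = of_int (s * s)"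
    by (simp add: power2_eq_square)
  consider "b \<ge> 0" "s \<ge> 0" | "b \<ge> 0" "s < 0" | "b < 0" "s > 0" | "b < 0" "s \<le> 0" by linarith
  then show ?thesis
  proof cases
    case 1
    then have "zv x > 0 \<longleftrightarrow> of_int s + of_int b * sqrt 5 > 0" using zv by linarith
    also have "\<dots> \<longleftrightarrow> s > 0 \<or> b > 0"
    proof -
      have "of_int b * sqrt 5 > 0 \<longleftrightarrow> b > 0" "of_int b * sqrt 5 \<ge> 0"
        using 1 by (simp_all add: zero_less_mult_iff)
      then show ?thesis using 1 by (smt (verit) of_int_0_less_iff of_int_0_le_iff)
    qed
    finally show ?thesis using 1 by (simp add: x s_def Let_def zeval)
  next
    case 2
    then have "zv x > 0 \<longleftrightarrow> - of_int s < t" using zv by (simp add: t_def) linarith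
    also have "\<dots> \<longleftrightarrow> (- of_int s)\<^sup>2 < t\<^sup>2"
      using t0 2 power2_less_imp_less[of "- of_int s :: real" t]
        power_strict_mono[of "- of_int s :: real" t 2] by fastforce
    also have "\<dots> \<longleftrightarrow> s * s < 5 * b * b"
      using t2 s2 by (simp only: power2_minus of_int_less_iff)
    finally show ?thesis using 2 by (simp add: x s_def Let_def zeval)
  next
    case 3
    then have "zv x > 0 \<longleftrightarrow> t < of_int s" using zv by (simp add: t_def) linarith
    also have "\<dots> \<longleftrightarrow> t\<^sup>2 < (of_int s)\<^sup>2"
      using t0 3 power2_less_imp_less[of t "of_int s :: real"]
        power_strict_mono[of t "of_int s :: real" 2] by fastforce
    also have "\<dots> \<longleftrightarrow> 5 * b * b < s * s"
      using t2 s2 by (simp only: of_int_less_iff)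
    finally show ?thesis using 3 by (simp add: x s_def Let_def zeval)
  next
    case 4
    then have "of_int b * sqrt 5 \<le> 0" "(of_int s :: real) \<le> 0"
      by (simp_all add: mult_nonpos_nonneg)
    then have "\<not> zv x > 0" using zv by linarith
    then show ?thesis using 4 by (simp add: x s_def Let_def zeval)
  qed
qed

lemma ev_nth: "ev (x, y, z) $ 1 = zv x" "ev (x, y, z) $ 2 = zv y" "ev (x, y, z) $ 3 = zv z"
  by (simp_all add: ev_def)

lemma vec3_eq_iff: "(x :: real^3) = y \<longleftrightarrow> x $ 1 = y $ 1 \<and> x $ 2 = y $ 2 \<and> x $ 3 = y $ 3"
  by (simp add: vec_eq_iff forall_3)

lemma inner3: "(x :: real^3) \<bullet> y = x $ 1 * y $ 1 + x $ 2 * y $ 2 + x $ 3 * y $ 3"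
  by (simp add: inner_vec_def sum_3)

lemma cross3_nth:
  "cross3 x y $ 1 = x $ 2 * y $ 3 - x $ 3 * y $ 2"
  "cross3 x y $ 2 = x $ 3 * y $ 1 - x $ 1 * y $ 3"
  "cross3 x y $ 3 = x $ 1 * y $ 2 - x $ 2 * y $ 1"
  by (simp_all add: cross3_def)

lemma ev_zdot: "ev p \<bullet> ev q = zv (zdot p q)"
  by (cases p; cases q) (auto simp: inner3 ev_nth zv_simps zdot.simps zcross.simps zscale.simps zvadd.simps)

lemma ev_zcross: "ev (zcross p q) = cross3 (ev p) (ev q)"
  by (cases p; cases q) (auto simp: vec3_eq_iff cross3_nth ev_nth zv_simps zdot.simps zcross.simps zscale.simps zvadd.simps)

lemma ev_zdet: "cross3 (ev p) (ev q) \<bullet> ev r = zv (zdet p q r)"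
  by (simp add: zdet_def ev_zdot[symmetric] ev_zcross)

lemma ev_zscale: "ev (zscale c p) = zv c *\<^sub>R ev p"
  by (cases p) (auto simp: vec3_eq_iff ev_nth zv_simps zdot.simps zcross.simps zscale.simps zvadd.simps)

lemma ev_zvadd: "ev (zvadd p q) = ev p + ev q"
  by (cases p; cases q) (auto simp: vec3_eq_iff ev_nth zv_simps zdot.simps zcross.simps zscale.simps zvadd.simps)

lemma zv_consts: "zv (0,0) = 0" "zv (1,0) = 1" "zv (-1,0) = -1" "zv (0,1) = gold" "zv (0,-1) = - gold"
  "zv (-1,1) = 1 / gold" "zv (1,-1) = - (1 / gold)" "zv (-1,2) = sqrt 5"
  unfolding inverse_gold by (simp_all add: zv_def) (simp add: gold_def field_simps)

abbreviation zneg :: "zvec \<Rightarrow> zvec" where "zneg \<equiv> zscale (-1,0)"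

lemma ev_zneg: "ev (zneg p) = - ev p"
  by (simp add: ev_zscale zv_consts)

text \<open>The order matters: the first four entries are the vertices of the standard cube with
  coordinate product 1, the last four those with product -1.\<close>

definition VL :: "zvec list" where "VL =
 [((1,0),(1,0),(1,0)), ((1,0),(-1,0),(-1,0)), ((-1,0),(1,0),(-1,0)), ((-1,0),(-1,0),(1,0)),
  ((0,0),(-1,1),(0,1)), ((0,0),(1,-1),(0,1)), ((-1,1),(0,1),(0,0)), ((1,-1),(0,1),(0,0)),
  ((0,1),(0,0),(-1,1)), ((0,1),(0,0),(1,-1)),
  ((0,-1),(0,0),(-1,1)), ((0,-1),(0,0),(1,-1)), ((-1,1),(0,-1),(0,0)), ((1,-1),(0,-1),(0,0)),
  ((0,0),(-1,1),(0,-1)), ((0,0),(1,-1),(0,-1)),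
  ((1,0),(1,0),(-1,0)), ((1,0),(-1,0),(1,0)), ((-1,0),(1,0),(1,0)), ((-1,0),(-1,0),(-1,0))]"

lemma sgn_pairs:
  "{f s t | s t. s \<in> {-1,1::real} \<and> t \<in> {-1,1::real}} = {f (-1) (-1), f (-1) 1, f 1 (-1), f 1 1}"
  by auto

lemma sgn_triples:
  "{f s1 s2 s3 | s1 s2 s3. s1 \<in> {-1,1::real} \<and> s2 \<in> {-1,1::real} \<and> s3 \<in> {-1,1::real}} =
     {f (-1) (-1) (-1), f (-1) (-1) 1, f (-1) 1 (-1), f (-1) 1 1,
      f 1 (-1) (-1), f 1 (-1) 1, f 1 1 (-1), f 1 1 1}"
  by auto

lemma Vert_eq: "Vert = ev ` set VL"
proof -
  let ?VL' = "[((0,-1),(0,0),(1,-1)), ((0,-1),(0,0),(-1,1)), ((0,1),(0,0),(1,-1)), ((0,1),(0,0),(-1,1)),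
    ((1,-1),(0,-1),(0,0)), ((1,-1),(0,1),(0,0)), ((-1,1),(0,-1),(0,0)), ((-1,1),(0,1),(0,0)),
    ((0,0),(1,-1),(0,-1)), ((0,0),(1,-1),(0,1)), ((0,0),(-1,1),(0,-1)), ((0,0),(-1,1),(0,1)),
    ((-1,0),(-1,0),(-1,0)), ((-1,0),(-1,0),(1,0)), ((-1,0),(1,0),(-1,0)), ((-1,0),(1,0),(1,0)),
    ((1,0),(-1,0),(-1,0)), ((1,0),(-1,0),(1,0)), ((1,0),(1,0),(-1,0)), ((1,0),(1,0),(1,0))]"
  have "set VL = set ?VL'" by code_simp
  moreover have "Vert = ev ` set ?VL'"
    unfolding Vert_def sgn_pairs sgn_triples
    by (simp add: ev_def zv_consts Un_insert_left)
  ultimately show ?thesis by simp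
qed

subsection \<open>The dodecahedral graph\<close>

text \<open>The pair (-1,2) is 2 phi - 1 = sqrt 5, the inner product of the two ends of an
  edge.\<close>

definition zadj :: "zvec \<Rightarrow> zvec \<Rightarrow> bool" where "zadj p q \<longleftrightarrow> zdot p q = (-1, 2)"

lemma VL_dots:
  "list_all (\<lambda>p. list_all (\<lambda>q. (if p = q then zdot p q = (3,0)
     else zadj p q \<or> zpos (zsub (-1,2) (zdot p q)))) VL) VL"
  by code_simp

lemma sqrt5_less: "sqrt 5 < 3"
  by (rule real_less_lsqrt) simp_all

text \<open>Equal images would have inner product 3, while distinct entries of \<open>VL\<close>
  have inner product at most sqrt 5.\<close>

lemma inj_ev: "inj_on ev (set VL)"
proof (rule inj_onI)
  fix p q assume "p \<in> set VL" "q \<in> set VL" and eq: "ev p = ev q"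
  then have c: "if p = q then zdot p q = (3,0) else zadj p q \<or> zpos (zsub (-1,2) (zdot p q))"
      "zdot p p = (3,0)"
    using VL_dots unfolding list_all_iff by (blast, metis)
  have "zv (zdot p q) = 3"
    using ev_zdot[of p q] ev_zdot[of p p] eq c(2) by (simp add: zv_def)
  then show "p = q"
    using c(1) sqrt5_less by (auto simp: zpos_iff zv_simps zv_consts zadj_def split: if_splits)
qed

lemma inner_Vert_self: "x \<in> Vert \<Longrightarrow> x \<bullet> x = 3"
  using VL_dots by (auto simp: Vert_eq list_all_iff ev_zdot zv_def split: if_splits)

lemma inner_Vert_le:
  assumes "x \<in> Vert" "y \<in> Vert" "x \<noteq> y"
  shows "x \<bullet> y \<le> sqrt 5"
proof -
  obtain p q where p: "p \<in> set VL" "x = ev p" and q: "q \<in> set VL" "y = ev q"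
    using assms by (auto simp: Vert_eq)
  then have "if p = q then zdot p q = (3,0) else zadj p q \<or> zpos (zsub (-1,2) (zdot p q))"
    using VL_dots unfolding list_all_iff by blast
  then show ?thesis
    using assms(3) p(2) q(2)
    by (auto simp: ev_zdot zpos_iff zv_simps zv_consts zadj_def split: if_splits)
qed

lemma dist_Vert:
  assumes "x \<in> Vert" "y \<in> Vert"
  shows "(dist x y)\<^sup>2 = 6 - 2 * (x \<bullet> y)"
  using inner_Vert_self assms
  by (simp add: dist_norm power2_norm_eq_inner inner_diff_left inner_diff_right inner_commute)

text \<open>All vertices have squared norm 3, so the squared distance is 6 - 2 (x \<bullet> y), and
  minimal distance means maximal inner product.\<close>

lemma dadj_iff: "dadj x y \<longleftrightarrow> x \<in> Vert \<and> y \<in> Vert \<and> x \<bullet> y = sqrt 5"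
proof
  assume a: "dadj x y"
  then have xy: "x \<in> Vert" "y \<in> Vert" "x \<noteq> y" by (auto simp: dadj_def)
  \<comment> \<open>A sample edge, showing that the bound sqrt 5 is attained.\<close>
  let ?z = "ev ((1,0),(1,0),(1,0))" and ?w = "ev ((0,0),(-1,1),(0,1))"
  have zw: "?z \<in> Vert" "?w \<in> Vert" by (auto simp: Vert_eq VL_def)
  have i: "?z \<bullet> ?w = sqrt 5" by (simp add: ev_zdot zeval zv_consts)
  then have "?z \<noteq> ?w" using inner_Vert_self[OF zw(1)] sqrt5_less by auto
  then have "dist x y \<le> dist ?z ?w" using a zw unfolding dadj_def by blast
  then have "(dist x y)\<^sup>2 \<le> (dist ?z ?w)\<^sup>2" by (simp add: power_mono)
  then have "x \<bullet> y \<ge> sqrt 5" using i xy zw by (simp add: dist_Vert)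
  then show "x \<in> Vert \<and> y \<in> Vert \<and> x \<bullet> y = sqrt 5"
    using inner_Vert_le[of x y] xy by auto
next
  assume a: "x \<in> Vert \<and> y \<in> Vert \<and> x \<bullet> y = sqrt 5"
  then have ne: "x \<noteq> y" using inner_Vert_self[of x] sqrt5_less by auto
  have "dist x y \<le> dist z w" if "z \<in> Vert" "w \<in> Vert" "z \<noteq> w" for z w
  proof -
    have "(dist x y)\<^sup>2 \<le> (dist z w)\<^sup>2"
      using that a inner_Vert_le[of z w] by (simp add: dist_Vert)
    then show ?thesis by (rule power2_le_imp_le) simp
  qed
  then show "dadj x y" using a ne unfolding dadj_def by blast
qed

lemma dadj_ev:
  assumes "p \<in> set VL" "q \<in> set VL"
  shows "dadj (ev p) (ev q) \<longleftrightarrow> zadj p q"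
proof -
  have c: "if p = q then zdot p q = (3,0) else zadj p q \<or> zpos (zsub (-1,2) (zdot p q))"
    using VL_dots assms unfolding list_all_iff by blast
  have "\<not> zadj p p" using VL_dots assms by (auto simp: list_all_iff zadj_def)
  then show ?thesis
    using c assms sqrt5_less
    by (auto simp: dadj_iff Vert_eq ev_zdot zpos_iff zv_simps zv_consts zadj_def zv_def[of "(3,0)"]
        split: if_splits)
qed

lemma ccw_iff: "ccw x a b \<longleftrightarrow> cross3 a b \<bullet> x > 0"
proof -
  have "cross3 (a - x) (b - x) \<bullet> x = cross3 a b \<bullet> x"
    by (simp add: inner3 cross3_nth algebra_simps)
  then show ?thesis by (simp add: ccw_def)
qed

lemma Vert_minus: "- x \<in> Vert \<longleftrightarrow> x \<in> Vert"
proof -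
  have "list_all (\<lambda>p. zneg p \<in> set VL) VL" by code_simp
  then have "- x \<in> Vert" if "x \<in> Vert" for x
    using that by (auto simp: Vert_eq list_all_iff ev_zneg[symmetric])
  from this[of x] this[of "- x"] show ?thesis by auto
qed

lemma finite_Vert: "finite Vert" by (simp add: Vert_eq)

lemma dadj_sym: "dadj x y \<longleftrightarrow> dadj y x"
  by (auto simp: dadj_iff inner_commute)

lemma dadj_minus: "dadj (- x) (- y) \<longleftrightarrow> dadj x y"
  by (simp add: dadj_iff Vert_minus)

lemma dadj_Vert: "dadj x y \<Longrightarrow> x \<in> Vert" "dadj x y \<Longrightarrow> y \<in> Vert"
  by (auto simp: dadj_iff)

lemma finite_nbrs: "finite {y. dadj x y \<and> P y}"
  by (rule finite_subset[OF _ finite_Vert]) (auto simp: dadj_iff)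

text \<open>A determinant of three vectors changes sign under the antipodal map, so the map reverses
  the cyclic order around a vertex.\<close>

lemma ccw_minus: "ccw (- x) (- a) (- b) \<longleftrightarrow> ccw x b a"
  by (simp add: ccw_iff cross_skew[of b a])

lemma ccw_asym: "ccw x a b \<Longrightarrow> \<not> ccw x b a"
  by (simp add: ccw_iff cross_skew[of b a])

lemma ccw_irrefl: "\<not> ccw x a a"
  by (simp add: ccw_iff)

definition nx_check :: "zvec \<Rightarrow> zvec list \<Rightarrow> bool" where
  "nx_check p N \<longleftrightarrow> list_all (\<lambda>q. list_ex (\<lambda>r. list_ex (\<lambda>s.
     list_all (\<lambda>t. t = q \<or> t = r \<or> t = s) N \<and> zpos (zdet q r p) \<and> zpos (zdet r s p) \<and> zpos (zdet s q p)) N) N) N"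

lemma VL_nbrs: "list_all (\<lambda>p. nx_check p (filter (zadj p) VL)) VL"
  by code_simp

lemma nbrs_ev:
  assumes "p \<in> set VL"
  shows "{a. dadj (ev p) a} = ev ` set (filter (zadj p) VL)"
proof -
  have "dadj (ev p) a \<longleftrightarrow> (\<exists>q\<in>set VL. a = ev q \<and> zadj p q)" for a
    using dadj_ev[OF assms] dadj_Vert(2)[of "ev p" a] unfolding Vert_eq by blast
  then show ?thesis unfolding set_filter by blast
qed

lemma nbrs_cycle:
  assumes "dadj x a"
  obtains b c where "{y. dadj x y} = {a, b, c}" "ccw x a b" "ccw x b c" "ccw x c a"
proof -
  obtain p where p: "p \<in> set VL" "x = ev p" using assms by (auto simp: dadj_iff Vert_eq)
  note N = nbrs_ev[OF p(1)]
  have "a \<in> {y. dadj x y}" using assms by simp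
  then obtain q where q: "q \<in> set (filter (zadj p) VL)" "a = ev q"
    unfolding p N by blast
  have "nx_check p (filter (zadj p) VL)" using VL_nbrs p by (auto simp: list_all_iff)
  then obtain r s where "set (filter (zadj p) VL) = {q,r,s}"
    and "zpos (zdet q r p)" "zpos (zdet r s p)" "zpos (zdet s q p)"
    using q(1) unfolding nx_check_def list_all_iff list_ex_iff by blast
  then show thesis using that[of "ev r" "ev s"] q(2) N p(2)
    by (simp add: ccw_iff zpos_iff ev_zdet)
qed

definition nx :: "real^3 \<Rightarrow> real^3 \<Rightarrow> real^3" where
  "nx x a = (THE b. dadj x b \<and> ccw x a b)"

lemma nx_props:
  assumes "dadj x a"
  shows "{y. dadj x y} = {a, nx x a, nx x (nx x a)}" "nx x (nx x (nx x a)) = a"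
    "\<And>b. dadj x b \<Longrightarrow> ccw x a b \<longleftrightarrow> b = nx x a"
    "nx x a \<noteq> a" "nx x (nx x a) \<noteq> a" "nx x (nx x a) \<noteq> nx x a"
    "dadj x (nx x a)" "dadj x (nx x (nx x a))"
proof -
  obtain b c where N: "{y. dadj x y} = {a, b, c}" and bc: "ccw x a b" "ccw x b c" "ccw x c a"
    using nbrs_cycle[OF assms] .
  have D: "dadj x y \<longleftrightarrow> y = a \<or> y = b \<or> y = c" for y using N by auto
  note bc' = bc[THEN ccw_asym] ccw_irrefl
  have 1: "nx x a = b" "nx x b = c" "nx x c = a"
    unfolding nx_def D using bc bc' by (auto intro!: the_equality)
  show "{y. dadj x y} = {a, nx x a, nx x (nx x a)}" "nx x (nx x (nx x a)) = a" using 1 N by auto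
  show "\<And>b. dadj x b \<Longrightarrow> ccw x a b \<longleftrightarrow> b = nx x a" using 1 bc bc' by (auto simp: D)
  show "nx x a \<noteq> a" "nx x (nx x a) \<noteq> a" "nx x (nx x a) \<noteq> nx x a"
    "dadj x (nx x a)" "dadj x (nx x (nx x a))" using 1 bc bc' by (auto simp: D)
qed

text \<open>As the antipodal map reverses the cyclic order, it turns successors into
  predecessors.\<close>

lemma nx_minus:
  assumes "dadj x a"
  shows "nx (- x) (- nx x a) = - a"
proof -
  have "ccw x a (nx x a)" using nx_props(3,7)[OF assms] by blast
  then have "ccw (- x) (- nx x a) (- a)" by (simp add: ccw_minus)
  then show ?thesis
    using nx_props(3)[of "- x" "- nx x a" "- a"] nx_props(7)[OF assms] assms by (simp add: dadj_minus)
qed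

subsection \<open>Faces\<close>

text \<open>Outward face normals, scaled to have inner product \<open>\<phi>\<^sup>2 = 1 + \<phi>\<close> with the vertices of the face.\<close>
definition FL :: "zvec list" where "FL =
  [((1,0),(0,0),(0,1)), ((1,0),(0,0),(0,-1)), ((-1,0),(0,0),(0,1)), ((-1,0),(0,0),(0,-1)),
   ((0,0),(0,1),(1,0)), ((0,0),(0,-1),(1,0)), ((0,0),(0,1),(-1,0)), ((0,0),(0,-1),(-1,0)),
   ((0,1),(1,0),(0,0)), ((0,-1),(1,0),(0,0)), ((0,1),(-1,0),(0,0)), ((0,-1),(-1,0),(0,0))]"

definition pent :: "zvec \<Rightarrow> (real^3) set" where
  "pent f = {v \<in> Vert. ev f \<bullet> v = zv (1,1)}"

definition Pents :: "(real^3) set set" where "Pents = pent ` set FL"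

definition zpent :: "zvec \<Rightarrow> zvec \<Rightarrow> bool" where "zpent f p \<longleftrightarrow> zdot f p = (1,1)"

lemma FL_dots: "list_all (\<lambda>f. list_all (\<lambda>p. zpent f p \<or> zpos (zsub (1,1) (zdot f p))) VL) FL"
  by code_simp

lemma FL_le:
  assumes "f \<in> set FL" "v \<in> Vert"
  shows "ev f \<bullet> v \<le> zv (1,1)"
proof -
  obtain p where "p \<in> set VL" "v = ev p" using assms by (auto simp: Vert_eq)
  moreover from this have "zpent f p \<or> zpos (zsub (1,1) (zdot f p))"
    using FL_dots assms unfolding list_all_iff by blast
  ultimately show ?thesis by (auto simp: ev_zdot zpos_iff zv_simps zpent_def)
qed

lemma pent_ev:
  assumes "f \<in> set FL"
  shows "p \<in> set VL \<Longrightarrow> ev p \<in> pent f \<longleftrightarrow> zpent f p"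
    and "pent f = ev ` set (filter (zpent f) VL)"
proof -
  show 1: "ev p \<in> pent f \<longleftrightarrow> zpent f p" if "p \<in> set VL" for p
  proof -
    have "zpent f p \<or> zpos (zsub (1,1) (zdot f p))"
      using FL_dots assms that unfolding list_all_iff by blast
    then show ?thesis using that by (auto simp: pent_def Vert_eq ev_zdot zpos_iff zv_simps zpent_def)
  qed
  have "pent f \<subseteq> Vert" by (auto simp: pent_def)
  then show "pent f = ev ` set (filter (zpent f) VL)"
    using 1 unfolding Vert_eq set_filter by blast
qed

text \<open>Used to place the centroid of each pentagon on the ray of its normal; the pair (2,1) is
  2 + phi.\<close>

lemma FL_sum:
  "list_all (\<lambda>f. foldr zvadd (filter (zpent f) VL) ((0,0),(0,0),(0,0)) = zscale (2,1) f \<and>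
     list_ex (zpent f) VL) FL"
  by code_simp

lemma ev_foldr: "ev (foldr zvadd ps ((0,0),(0,0),(0,0))) = (\<Sum>p\<leftarrow>ps. ev p)"
proof (induction ps)
  case Nil
  show ?case by (simp add: vec3_eq_iff ev_nth zv_consts)
qed (simp add: ev_zvadd)

lemma distinct_VL: "distinct VL"
  by code_simp

lemma centroid_pent:
  assumes "f \<in> set FL"
  obtains c where "c > 0" "centroid (pent f) = c *\<^sub>R ev f"
proof
  let ?ps = "filter (zpent f) VL"
  have "inj_on ev (set ?ps)" using inj_ev by (rule inj_on_subset) auto
  then have "(\<Sum>v\<in>pent f. v) = (\<Sum>p\<in>set ?ps. ev p)"
    unfolding pent_ev(2)[OF assms] by (simp add: sum.reindex)
  also have "\<dots> = (\<Sum>p\<leftarrow>?ps. ev p)"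
    using distinct_VL by (simp add: sum_list_distinct_conv_sum_set)
  also have "\<dots> = zv (2,1) *\<^sub>R ev f"
    using FL_sum assms by (simp add: ev_foldr[symmetric] list_all_iff ev_zscale)
  finally show "centroid (pent f) = (zv (2,1) / card (pent f)) *\<^sub>R ev f"
    by (simp add: centroid_def)
  have "\<exists>p\<in>set VL. zpent f p" using FL_sum assms by (simp add: list_all_iff list_ex_iff)
  then have "pent f \<noteq> {}" unfolding pent_ev(2)[OF assms] set_filter by blast
  moreover have "finite (pent f)" unfolding pent_ev(2)[OF assms] by simp
  moreover have "zv (2,1) > 0" using gold_pos by (simp add: zv_def)
  ultimately show "zv (2,1) / card (pent f) > 0" by (simp add: card_gt_0_iff)
qed

text \<open>The centroid is a positive multiple of the normal, and subtracting it from
  \<open>a\<close> and \<open>b\<close> leaves a determinant whose third column is parallel to it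
  unchanged.\<close>

lemma fedge_pent:
  assumes "f \<in> set FL"
  shows "fedge (pent f) a b \<longleftrightarrow> a \<in> pent f \<and> b \<in> pent f \<and> dadj a b \<and> cross3 a b \<bullet> ev f > 0"
proof -
  obtain c where c: "c > 0" "centroid (pent f) = c *\<^sub>R ev f" using centroid_pent[OF assms] .
  have "cross3 (a - c *\<^sub>R ev f) (b - c *\<^sub>R ev f) \<bullet> (c *\<^sub>R ev f) = c * (cross3 a b \<bullet> ev f)"
    by (simp add: inner3 cross3_nth algebra_simps)
  then show ?thesis unfolding fedge_def c(2) using c(1) by (simp add: zero_less_mult_iff)
qed

definition zfedge :: "zvec \<Rightarrow> zvec \<Rightarrow> zvec \<Rightarrow> bool" where
  "zfedge f p q \<longleftrightarrow> zpent f p \<and> zpent f q \<and> zadj p q \<and> zpos (zdet p q f)"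

lemma fedge_ev:
  assumes "f \<in> set FL" "p \<in> set VL" "q \<in> set VL"
  shows "fedge (pent f) (ev p) (ev q) \<longleftrightarrow> zfedge f p q"
  using assms by (simp add: fedge_pent pent_ev(1) dadj_ev zfedge_def zpos_iff ev_zdet)

lemma fedge_dadj: "fedge S a b \<Longrightarrow> dadj a b"
  by (simp add: fedge_def)

lemma fedge_asym: "fedge S a b \<Longrightarrow> \<not> fedge S b a"
  by (simp add: fedge_def cross_skew[of "b - _"])

lemma VL_left_face:
  "list_all (\<lambda>p. list_all (\<lambda>q.
     list_ex (\<lambda>f. list_all (\<lambda>f'. zfedge f' p q \<longleftrightarrow> f' = f) FL) FL) (filter (zadj p) VL)) VL"
  by code_simp

lemma left_face_ex1:
  assumes "dadj x a"
  shows "\<exists>!S. S \<in> Pents \<and> fedge S x a"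
proof -
  obtain p q where p: "p \<in> set VL" "x = ev p" and q: "q \<in> set VL" "a = ev q"
    using assms by (auto simp: dadj_iff Vert_eq)
  have "zadj p q" using assms dadj_ev p q by blast
  then obtain f where f: "f \<in> set FL" "\<And>f'. f' \<in> set FL \<Longrightarrow> zfedge f' p q \<longleftrightarrow> f' = f"
    using VL_left_face p(1) q(1) unfolding list_all_iff list_ex_iff set_filter by blast
  have "fedge S x a \<longleftrightarrow> S = pent f" if "S \<in> Pents" for S
    using that fedge_ev[OF _ p(1) q(1)] f unfolding Pents_def p(2) q(2) by blast
  moreover have "pent f \<in> Pents" using f(1) by (auto simp: Pents_def)
  ultimately show ?thesis by blast
qed

definition lf :: "real^3 \<Rightarrow> real^3 \<Rightarrow> (real^3) set" where
  "lf x a = (THE S. S \<in> Pents \<and> fedge S x a)"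

lemma lf_Pents: "dadj x a \<Longrightarrow> lf x a \<in> Pents"
  using theI'[OF left_face_ex1] unfolding lf_def by blast

lemma fedge_lf: "dadj x a \<Longrightarrow> S \<in> Pents \<Longrightarrow> fedge S x a \<longleftrightarrow> S = lf x a"
  using theI'[OF left_face_ex1] left_face_ex1 unfolding lf_def by blast

definition rot_check :: "zvec \<Rightarrow> zvec list \<Rightarrow> bool" where
  "rot_check p N \<longleftrightarrow> list_all (\<lambda>q. list_all (\<lambda>r. zpos (zdet q r p) \<longrightarrow>
     list_all (\<lambda>f. zfedge f p q \<longleftrightarrow> zfedge f r p) FL) N) N"

lemma VL_rot: "list_all (\<lambda>p. rot_check p (filter (zadj p) VL)) VL"
  by code_simp

text \<open>The face in the corner at \<open>x\<close> between \<open>a\<close> and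
  \<open>nx x a\<close> has a counterclockwise boundary that enters \<open>x\<close> from
  \<open>nx x a\<close> and leaves towards \<open>a\<close>.\<close>

lemma lf_rot:
  assumes "dadj x a"
  shows "lf (nx x a) x = lf x a"
proof -
  have b: "dadj x (nx x a)" "ccw x a (nx x a)" using nx_props(3,7)[OF assms] by blast+
  obtain p q r where p: "p \<in> set VL" "x = ev p" and q: "q \<in> set VL" "a = ev q"
      and r: "r \<in> set VL" "nx x a = ev r"
    using assms b(1) unfolding dadj_iff Vert_eq by blast
  have "zadj p q" "zadj p r" "zpos (zdet q r p)"
    using assms b dadj_ev p q r by (simp_all add: zpos_iff ev_zdet ccw_iff)
  then have *: "zfedge f p q \<longleftrightarrow> zfedge f r p" if "f \<in> set FL" for f
    using VL_rot p(1) q(1) r(1) that unfolding list_all_iff rot_check_def set_filter by blast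
  have "fedge S x a \<longleftrightarrow> fedge S (nx x a) x" if "S \<in> Pents" for S
  proof -
    obtain f where "f \<in> set FL" "S = pent f" using \<open>S \<in> Pents\<close> unfolding Pents_def by blast
    then show ?thesis using * fedge_ev[of f p q] fedge_ev[of f r p] p q r by simp
  qed
  then show ?thesis unfolding lf_def by metis
qed

lemma lf_neq: "dadj x a \<Longrightarrow> lf x a \<noteq> lf a x"
  using fedge_lf fedge_asym lf_Pents dadj_sym by metis

lemma finite_dfaces: "finite dfaces"
  by (rule finite_subset[of _ "Pow Vert"]) (auto simp: dfaces_def finite_Vert)

definition dim_check :: "zvec list \<Rightarrow> bool" where
  "dim_check P \<longleftrightarrow> list_ex (\<lambda>p. list_ex (\<lambda>q. list_ex (\<lambda>r. zpos (zdet p q r)) P) P) P"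

lemma FL_dim: "list_all (\<lambda>f. dim_check (filter (zpent f) VL)) FL"
  by code_simp

lemma dim_cross3:
  fixes S :: "(real^3) set"
  assumes "a \<in> S" "b \<in> S" "c \<in> S" and det: "cross3 a b \<bullet> c \<noteq> 0"
  shows "dim S = 3"
proof (rule ccontr)
  assume "dim S \<noteq> 3"
  then have "dim S < DIM(real^3)" using dim_subset_UNIV[of S] by (simp add: DIM_cart)
  then obtain n where n: "n \<noteq> 0" "span S \<subseteq> {x. n \<bullet> x = 0}"
    using lowdim_subset_hyperplane by blast
  then have z: "n \<bullet> a = 0" "n \<bullet> b = 0" "n \<bullet> c = 0" using assms span_base by blast+
  \<comment> \<open>Cramer's rule: \<open>n\<close> expanded in the basis dual to \<open>a\<close>,
    \<open>b\<close>, \<open>c\<close>.\<close>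
  have "(cross3 a b \<bullet> c) *\<^sub>R n = (n \<bullet> a) *\<^sub>R cross3 b c + (n \<bullet> b) *\<^sub>R cross3 c a + (n \<bullet> c) *\<^sub>R cross3 a b"
    by (simp add: vec3_eq_iff inner3 cross3_nth algebra_simps)
  then show False using z det n(1) by simp
qed

text \<open>The normal gives a supporting plane, so the intersection with the hull is a face. Its
  affine hull misses 0 and its linear span is all of space, which makes its affine dimension
  2.\<close>

lemma pent_dfaces:
  assumes f: "f \<in> set FL"
  shows "pent f \<in> dfaces"
proof -
  let ?H = "{x. ev f \<bullet> x = zv (1,1)}"
  define F where "F = convex hull Vert \<inter> ?H"
  have "convex hull Vert \<subseteq> {x. ev f \<bullet> x \<le> zv (1,1)}"
    by (rule hull_minimal) (auto simp: convex_halfspace_le FL_le[OF f])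
  then have face: "F face_of convex hull Vert"
    unfolding F_def by (intro face_of_Int_supporting_hyperplane_le) auto
  have sub: "pent f \<subseteq> F" unfolding F_def pent_def by (auto intro: hull_inc)
  have "dim_check (filter (zpent f) VL)" using FL_dim f by (auto simp: list_all_iff)
  then obtain p q r where pqr: "{p,q,r} \<subseteq> set (filter (zpent f) VL)" and det: "zpos (zdet p q r)"
    unfolding dim_check_def list_ex_iff by blast
  have "{ev p, ev q, ev r} \<subseteq> F" using pqr sub pent_ev(2)[OF f] by blast
  moreover have "cross3 (ev p) (ev q) \<bullet> ev r \<noteq> 0" using det by (simp add: ev_zdet zpos_iff)
  ultimately have dim: "dim F = 3" using dim_cross3[of "ev p" F "ev q" "ev r"] by blast
  have "affine hull F \<subseteq> ?H" by (rule hull_minimal) (auto simp: F_def affine_hyperplane)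
  moreover have "zv (1,1) > 0" using gold_pos by (simp add: zv_def)
  ultimately have "0 \<notin> affine hull F" by auto
  then have "aff_dim (insert 0 F) = aff_dim F + 1" by (simp add: aff_dim_insert)
  moreover have "aff_dim (insert 0 F) = 3"
    using aff_dim_zero[of "insert 0 F"] dim by (simp add: hull_inc dim_insert span_zero)
  ultimately have "aff_dim F = 2" by simp
  moreover have "pent f = Vert \<inter> F" unfolding F_def pent_def by (auto intro: hull_inc)
  ultimately show ?thesis unfolding dfaces_def using face by blast
qed

text \<open>Ensures that the faces \<open>lf x a\<close> occur in the sums over
  \<open>dfaces\<close>; the coefficient functions used later vanish outside
  \<open>Pents\<close>.\<close>

lemma Pents_dfaces: "Pents \<subseteq> dfaces"
  using pent_dfaces by (auto simp: Pents_def)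

subsection \<open>Cycles with vanishing intersection numbers are null-homologous\<close>

text \<open>Entry \<open>i\<close> of \<open>NL\<close> lists the neighbours of vertex \<open>i\<close>; an entry \<open>(i, j, k, l)\<close> of \<open>EL\<close> is the
  edge from vertex \<open>i\<close> to vertex \<open>j\<close> with face \<open>k\<close> on its left and face \<open>l\<close> on its right.\<close>
definition NL :: "nat list list" where "NL =
   [[4,6,8], [9,12,15], [7,11,14], [5,10,13], [0,5,18], [3,4,17], [0,7,16],
    [2,6,18], [0,9,17], [1,8,16], [3,11,18], [2,10,19], [1,13,17], [3,12,19],
    [2,15,16], [1,14,19], [6,9,14], [5,8,12], [4,7,10], [11,13,15]]"

definition EL :: "(nat \<times> nat \<times> nat \<times> nat) list" where "EL =
   [(0,4,0,4), (0,6,4,8), (0,8,8,0), (1,9,10,1), (1,12,7,10), (1,15,1,7), (2,7,6,9),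
    (2,11,9,3), (2,14,3,6), (3,5,2,5), (3,10,11,2), (3,13,5,11), (4,5,0,2), (4,18,2,4),
    (5,17,0,5), (6,7,4,6), (6,16,6,8), (7,18,4,9), (8,9,8,10), (8,17,10,0), (9,16,8,1),
    (10,11,11,9), (10,18,9,2), (11,19,11,3), (12,13,7,5), (12,17,5,10), (13,19,7,11), (14,15,3,1),
    (14,16,1,6), (15,19,3,7)]"

lemma NL_nbrs: "list_all (\<lambda>i. filter (zadj (VL ! i)) VL = map ((!) VL) (NL ! i)) [0..<20]"
  by code_simp

lemma EL_faces:
  "list_all (\<lambda>(i, j, k, l). k < 12 \<and> l < 12 \<and> zfedge (FL ! k) (VL ! i) (VL ! j) \<and>
     zfedge (FL ! l) (VL ! j) (VL ! i)) EL"
  by code_simp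

lemma EL_edges:
  "list_all (\<lambda>i. list_all (\<lambda>j. (if i < j then list_ex (\<lambda>(i', j', k, l). i' = i \<and> j' = j) EL
     else list_ex (\<lambda>(i', j', k, l). i' = j \<and> j' = i) EL)) (NL ! i)) [0..<20]"
  by code_simp

text \<open>The witness sums \<open>E\<close> along a spanning tree of the dual graph.\<close>
lemma dual_potential:
  fixes E :: "nat \<Rightarrow> nat \<Rightarrow> int"
  assumes anti: "\<And>i j. E j i = - E i j"
    and sums: "\<And>i. i < 20 \<Longrightarrow> (\<Sum>j\<leftarrow>NL ! i. E i j) = 0"
  obtains N where "list_all (\<lambda>(i, j, k, l). E i j = N k - N l) EL"
proof
  let ?N = "\<lambda>k. [0, E 0 8 - E 9 16, - E 4 5,
      - E 0 4 - E 6 7 + E 2 14, - E 0 4, - E 5 17,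
      - E 0 4 - E 6 7, - E 5 17 + E 12 13, E 0 8,
      - E 0 4 - E 7 18, E 8 17, - E 4 5 + E 3 10] ! k"
  \<comment> \<open>The twenty vertex conditions, with every edge running from the smaller to the
    larger index as in \<open>EL\<close>.\<close>
  have eqs: "E 0 4 + E 0 6 + E 0 8 = 0" "E 1 9 + E 1 12 + E 1 15 = 0"
    "E 2 7 + E 2 11 + E 2 14 = 0" "E 3 5 + E 3 10 + E 3 13 = 0"
    "E 4 5 + E 4 18 = E 0 4" "E 5 17 = E 3 5 + E 4 5"
    "E 6 7 + E 6 16 = E 0 6" "E 7 18 = E 2 7 + E 6 7"
    "E 8 9 + E 8 17 = E 0 8" "E 9 16 = E 1 9 + E 8 9"
    "E 10 11 + E 10 18 = E 3 10" "E 11 19 = E 2 11 + E 10 11"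
    "E 12 13 + E 12 17 = E 1 12" "E 13 19 = E 3 13 + E 12 13"
    "E 14 15 + E 14 16 = E 2 14" "E 15 19 = E 1 15 + E 14 15"
    "0 = E 6 16 + E 9 16 + E 14 16" "0 = E 5 17 + E 8 17 + E 12 17"
    "0 = E 4 18 + E 7 18 + E 10 18" "0 = E 11 19 + E 13 19 + E 15 19"
    using sums[of 0] sums[of 1] sums[of 2] sums[of 3] sums[of 4] sums[of 5]
      sums[of 6] sums[of 7] sums[of 8] sums[of 9] sums[of 10] sums[of 11]
      sums[of 12] sums[of 13] sums[of 14] sums[of 15] sums[of 16] sums[of 17]
      sums[of 18] sums[of 19]
    by (simp_all add: NL_def anti[of 0 4] anti[of 0 6] anti[of 0 8] anti[of 1 9] anti[of 1 12]
      anti[of 1 15] anti[of 2 7] anti[of 2 11] anti[of 2 14] anti[of 3 5]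
      anti[of 3 10] anti[of 3 13] anti[of 4 5] anti[of 4 18] anti[of 5 17]
      anti[of 6 7] anti[of 6 16] anti[of 7 18] anti[of 8 9] anti[of 8 17]
      anti[of 9 16] anti[of 10 11] anti[of 10 18] anti[of 11 19] anti[of 12 13]
      anti[of 12 17] anti[of 13 19] anti[of 14 15] anti[of 14 16] anti[of 15 19]
      del: One_nat_def)
  show "list_all (\<lambda>(i, j, k, l). E i j = ?N k - ?N l) EL"
    using eqs by (simp add: EL_def)
qed

lemma list_all_upt: "list_all P [0..<n] \<longleftrightarrow> (\<forall>i<n. P i)"
  by (auto simp: list_all_iff)

lemma length_VL: "length VL = 20"
  by (simp add: VL_def)

lemma length_FL: "length FL = 12"
  by (simp add: FL_def)

lemma int_trc_VL:
  assumes "i < 20"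
  shows "int_trc h (ev (VL ! i)) = (\<Sum>j\<leftarrow>NL ! i. h (Ed (ev (VL ! i)) (ev (VL ! j))))"
proof -
  let ?p = "VL ! i"
  let ?ps = "filter (zadj ?p) VL"
  have p: "?p \<in> set VL" using assms by (simp add: length_VL)
  have "inj_on ev (set ?ps)" using inj_ev by (rule inj_on_subset) auto
  then have "int_trc h (ev ?p) = (\<Sum>q\<in>set ?ps. h (Ed (ev ?p) (ev q)))"
    unfolding int_trc_def nbrs_ev[OF p] by (simp add: sum.reindex)
  also have "\<dots> = (\<Sum>q\<leftarrow>?ps. h (Ed (ev ?p) (ev q)))"
    using distinct_VL by (simp add: sum_list_distinct_conv_sum_set)
  also have "?ps = map ((!) VL) (NL ! i)"
    using NL_nbrs assms unfolding list_all_upt by blast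
  finally show ?thesis by (simp add: comp_def)
qed

lemma chain1_rev: "chain1 c \<Longrightarrow> c (rev1 \<sigma>) = - c \<sigma>"
  by (simp add: chain1_def)

lemma chain1_Ed: "chain1 c \<Longrightarrow> c (Ed a x) = - c (Ed x a)"
  using chain1_rev[of c "Ed x a"] by simp

lemma chain1_Ar: "chain1 c \<Longrightarrow> c (Ar x b a) = - c (Ar x a b)"
  using chain1_rev[of c "Ar x a b"] by simp

lemma Vert_nthE:
  assumes "x \<in> Vert"
  obtains i where "i < 20" "x = ev (VL ! i)"
  using assms by (auto simp: Vert_eq in_set_conv_nth length_VL)

lemma dadj_nthE:
  assumes "dadj x a"
  obtains i j where "i < 20" "j < 20" "x = ev (VL ! i)" "a = ev (VL ! j)" "j \<in> set (NL ! i)"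
proof -
  obtain i where i: "i < 20" "x = ev (VL ! i)" using Vert_nthE dadj_Vert(1)[OF assms] by blast
  have "VL ! i \<in> set VL" using i by (simp add: length_VL)
  then have "a \<in> ev ` set (filter (zadj (VL ! i)) VL)"
    using assms i(2) nbrs_ev[of "VL ! i"] by blast
  also have "filter (zadj (VL ! i)) VL = map ((!) VL) (NL ! i)"
    using NL_nbrs i(1) unfolding list_all_upt by blast
  finally obtain j where j: "j \<in> set (NL ! i)" "a = ev (VL ! j)" by auto
  moreover have "list_all (\<lambda>js. list_all (\<lambda>j. j < 20) js) NL" "length NL = 20" by (simp_all add: NL_def)
  then have "j < 20" using i(1) j(1) by (auto simp: list_all_iff)
  ultimately show thesis using that i by blast
qed

lemma inj_pent: "inj_on pent (set FL)"
proof (rule inj_onI)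
  fix f f' assume f: "f \<in> set FL" "f' \<in> set FL" "pent f = pent f'"
  have "list_all (\<lambda>f. list_all (\<lambda>f'. f = f' \<or> list_ex (\<lambda>p. zpent f p \<noteq> zpent f' p) VL) FL) FL"
    by code_simp
  then have "f = f' \<or> (\<exists>p\<in>set VL. zpent f p \<noteq> zpent f' p)"
    using f unfolding list_all_iff list_ex_iff by blast
  then show "f = f'" using f pent_ev(1) by blast
qed

lemma lf_nth:
  assumes "k < 12" "i < 20" "j < 20" "zfedge (FL ! k) (VL ! i) (VL ! j)"
  shows "lf (ev (VL ! i)) (ev (VL ! j)) = pent (FL ! k)"
proof -
  have "FL ! k \<in> set FL" "VL ! i \<in> set VL" "VL ! j \<in> set VL"
    using assms by (simp_all add: length_VL length_FL)
  then have "fedge (pent (FL ! k)) (ev (VL ! i)) (ev (VL ! j))" "pent (FL ! k) \<in> Pents"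
    using assms(4) fedge_ev by (auto simp: Pents_def)
  then show ?thesis using fedge_lf fedge_dadj by metis
qed

text \<open>Simple connectivity of the sphere: \<open>c\<close> is a closed cochain on the dual cell structure.\<close>
lemma edge_part_exact:
  assumes c: "chain1 c" and trc: "\<And>x. x \<in> Vert \<Longrightarrow> int_trc c x = 0"
  obtains n :: "(real^3) set \<Rightarrow> int" where
    "\<And>S. S \<notin> Pents \<Longrightarrow> n S = 0"
    "\<And>x a. dadj x a \<Longrightarrow> c (Ed x a) = n (lf x a) - n (lf a x)"
proof -
  define E where "E i j = c (Ed (ev (VL ! i)) (ev (VL ! j)))" for i j
  have "(\<Sum>j\<leftarrow>NL ! i. E i j) = 0" if "i < 20" for i
    using trc[of "ev (VL ! i)"] that int_trc_VL[OF that, of c]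
    by (simp add: E_def Vert_eq length_VL)
  moreover have "E j i = - E i j" for i j unfolding E_def by (rule chain1_Ed[OF c])
  ultimately obtain N where N: "list_all (\<lambda>(i, j, k, l). E i j = N k - N l) EL"
    using dual_potential[of E] by blast
  \<comment> \<open>Moves the potential from indices to faces. The index is unique because
    \<open>FL\<close> is distinct and \<open>pent\<close> is injective on it.\<close>
  define n where "n S = (if S \<in> Pents then N (THE k. k < 12 \<and> S = pent (FL ! k)) else 0)" for S
  note len = length_FL
  have dist: "distinct FL" by (simp add: FL_def)
  have n: "n (pent (FL ! k)) = N k" if "k < 12" for k
  proof -
    have "(THE k'. k' < 12 \<and> pent (FL ! k) = pent (FL ! k')) = k"
    proof (rule the_equality)
      fix k' assume k': "k' < 12 \<and> pent (FL ! k) = pent (FL ! k')"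
      then have "FL ! k' = FL ! k" using that len inj_onD[OF inj_pent, of "FL ! k" "FL ! k'"] by simp
      then show "k' = k" using k' that len dist nth_eq_iff_index_eq by metis
    qed (use that in simp)
    moreover have "pent (FL ! k) \<in> Pents" using that len by (simp add: Pents_def)
    ultimately show ?thesis by (simp add: n_def)
  qed
  have EL: "c (Ed x a) = n (lf x a) - n (lf a x)"
    if "(i, j, k, l) \<in> set EL" "i < 20" "j < 20" "x = ev (VL ! i)" "a = ev (VL ! j)" for i j k l x a
  proof -
    have "k < 12" "l < 12" "zfedge (FL ! k) (VL ! i) (VL ! j)" "zfedge (FL ! l) (VL ! j) (VL ! i)"
      using EL_faces that(1) by (auto simp: list_all_iff)
    then have "lf x a = pent (FL ! k)" "lf a x = pent (FL ! l)" "k < 12" "l < 12"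
      using that lf_nth by auto
    moreover have "E i j = N k - N l" using N that(1) by (auto simp: list_all_iff)
    ultimately show ?thesis using that n by (simp add: E_def)
  qed
  have "c (Ed x a) = n (lf x a) - n (lf a x)" if xa: "dadj x a" for x a
  proof -
    obtain i j where ij: "i < 20" "j < 20" "x = ev (VL ! i)" "a = ev (VL ! j)" "j \<in> set (NL ! i)"
      using dadj_nthE[OF xa] .
    have "if i < j then list_ex (\<lambda>(i', j', k, l). i' = i \<and> j' = j) EL
      else list_ex (\<lambda>(i', j', k, l). i' = j \<and> j' = i) EL"
      using EL_edges ij unfolding list_all_upt unfolding list_all_iff by blast
    then consider k l where "(i, j, k, l) \<in> set EL" | k l where "(j, i, k, l) \<in> set EL"
      by (auto simp: list_ex_iff split: if_splits)
    then show ?thesis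
    proof cases
      case 1
      then show ?thesis using EL ij by blast
    next
      case 2
      then have "c (Ed a x) = n (lf a x) - n (lf x a)" using EL ij by blast
      then show ?thesis using chain1_Ed[OF c, of a x] by simp
    qed
  qed
  moreover have "\<And>S. S \<notin> Pents \<Longrightarrow> n S = 0" by (simp add: n_def)
  ultimately show thesis using that by blast
qed

section \<open>Combinations of face boundaries on edges and arcs\<close>

lemma face_sum_Ed:
  assumes "\<And>S. S \<notin> Pents \<Longrightarrow> n S = 0" "dadj x a"
  shows "(\<Sum>S\<in>dfaces. n S * face_bd S (Ed x a)) = n (lf x a) - n (lf a x)"
proof -
  have a': "dadj a x" using assms dadj_sym by blast
  have "n S * face_bd S (Ed x a) = (if S = lf x a then n S else 0) - (if S = lf a x then n S else 0)" for S
    using assms(1)[of S] fedge_lf[OF assms(2), of S] fedge_lf[OF a', of S] lf_neq[OF assms(2)]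
    by (cases "S \<in> Pents") auto
  moreover have "lf x a \<in> dfaces" "lf a x \<in> dfaces"
    using lf_Pents assms(2) a' Pents_dfaces by blast+
  ultimately show ?thesis by (simp add: sum_subtractf finite_dfaces)
qed

lemma lf_rev:
  assumes "dadj x a"
  shows "lf a x = lf x (nx x (nx x a))"
  using lf_rot[OF nx_props(8)[OF assms]] nx_props(2)[OF assms] by simp

text \<open>Only one truncated face has a side between \<open>a\<close> and \<open>nx x a\<close>.
  Its boundary runs from \<open>nx x a\<close> to \<open>a\<close>, against the counterclockwise
  sense around \<open>x\<close>, which explains the signs.\<close>

lemma face_sum_Ar:
  assumes "\<And>S. S \<notin> Pents \<Longrightarrow> n S = 0" "dadj x a"
  shows "(\<Sum>S\<in>dfaces. n S * face_bd S (Ar x (nx x a) a)) = n (lf x a)"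
    and "(\<Sum>S\<in>dfaces. n S * face_bd S (Ar x a (nx x a))) = - n (lf x a)"
proof -
  note nx = nx_props[OF assms(2)]
  have fe: "fedge S (nx x a) x \<longleftrightarrow> S = lf x a" "fedge S x a \<longleftrightarrow> S = lf x a"
      "\<not> (fedge S a x \<and> fedge S x (nx x a))" if "S \<in> Pents" for S
  proof -
    show "fedge S (nx x a) x \<longleftrightarrow> S = lf x a"
      using fedge_lf[OF _ that] nx(7) dadj_sym lf_rot[OF assms(2)] by metis
    show "fedge S x a \<longleftrightarrow> S = lf x a" using fedge_lf[OF assms(2) that] .
    have "fedge S a x \<longleftrightarrow> S = lf a x" "fedge S (nx x (nx x a)) x \<longleftrightarrow> S = lf (nx x (nx x a)) x"
      "fedge S x (nx x a) \<longleftrightarrow> S = lf x (nx x a)" "fedge S x (nx x (nx x a)) \<longleftrightarrow> S = lf x (nx x (nx x a))"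
      using fedge_lf[OF _ that] nx(7,8) assms(2) dadj_sym by metis+
    then show "\<not> (fedge S a x \<and> fedge S x (nx x a))"
      using lf_rev[OF assms(2)] lf_rot[OF nx(7)] fedge_asym by metis
  qed
  have "n S * face_bd S (Ar x (nx x a) a) = (if S = lf x a then n S else 0)"
    "n S * face_bd S (Ar x a (nx x a)) = (if S = lf x a then - n S else 0)" for S
    using assms(1)[of S] fe[of S] by (cases "S \<in> Pents"; auto)+
  moreover have "lf x a \<in> dfaces" using lf_Pents[OF assms(2)] Pents_dfaces by blast
  ultimately show "(\<Sum>S\<in>dfaces. n S * face_bd S (Ar x (nx x a) a)) = n (lf x a)"
    "(\<Sum>S\<in>dfaces. n S * face_bd S (Ar x a (nx x a))) = - n (lf x a)"
    by (simp_all add: finite_dfaces)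
qed

lemma bd1_eq:
  assumes "dadj x a"
  shows "bd1 c (x, a) = c (Ed a x) + (\<Sum>b\<in>{b. dadj x b \<and> b \<noteq> a}. c (Ar x b a))"
proof -
  have "{\<sigma> \<in> cells1. tgt1 \<sigma> = (x, a)} = insert (Ed a x) ((\<lambda>b. Ar x b a) ` {b. dadj x b \<and> b \<noteq> a})"
    (is "?L = ?R")
  proof (intro equalityI subsetI)
    fix \<sigma> assume "\<sigma> \<in> ?L"
    then show "\<sigma> \<in> ?R" by (cases \<sigma>) (auto simp: cells1_def)
  qed (use assms dadj_sym in \<open>auto simp: cells1_def\<close>)
  then show ?thesis unfolding bd1_def
    by (simp add: finite_nbrs image_iff sum.reindex inj_on_def)
qed

lemma nbrs_other:
  assumes "dadj x a"
  shows "{b. dadj x b \<and> b \<noteq> a} = {nx x a, nx x (nx x a)}"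
    "{d. dadj x d \<and> d \<noteq> a \<and> ccw x a d} = {nx x a}"
    "{c. dadj x c \<and> c \<noteq> a \<and> ccw x c a} = {nx x (nx x a)}"
proof -
  note nx = nx_props[OF assms]
  have D: "dadj x b \<longleftrightarrow> b = a \<or> b = nx x a \<or> b = nx x (nx x a)" for b
    using nx(1) by (simp add: set_eq_iff)
  show 1: "{b. dadj x b \<and> b \<noteq> a} = {nx x a, nx x (nx x a)}" unfolding D using nx(4,5) by auto
  show "{d. dadj x d \<and> d \<noteq> a \<and> ccw x a d} = {nx x a}" by (auto simp: nx(3,4,7))
  have "ccw x (nx x (nx x a)) a" using nx_props(3)[OF nx(8) assms] nx(2) by simp
  moreover have "\<not> ccw x (nx x a) a" using nx_props(3)[OF nx(7) assms] nx(5) by metis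
  ultimately show "{c. dadj x c \<and> c \<noteq> a \<and> ccw x c a} = {nx x (nx x a)}"
    using D nx(5,8) by auto
qed

text \<open>The coefficient of the arc from \<open>a\<close> to its successor after identifying antipodal arcs.\<close>
definition arc_val :: "(cell1 \<Rightarrow> int) \<Rightarrow> real^3 \<Rightarrow> real^3 \<Rightarrow> int" where
  "arc_val c x a = c (Ar x a (nx x a)) - c (Ar (- x) (- nx x a) (- a))"

lemma nx_minus2:
  assumes "dadj x a"
  shows "nx (- x) (- a) = - nx x (nx x a)" "nx (- x) (- nx x (nx x a)) = - nx x a"
  using nx_minus[of x "nx x (nx x a)"] nx_minus[of x "nx x a"] nx_props[OF assms] by simp_all

text \<open>The point \<open>(x, a)\<close> lies on one edge and two arcs. Adding the boundary at
  the antipodal point pairs each arc with its antipode, which leaves two arc values and two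
  edges.\<close>

lemma cycle_arc_val:
  assumes c: "chain1 c" and x: "dadj x a"
  shows "bd1 c (x, a) + bd1 c (- x, - a) =
    arc_val c x (nx x (nx x a)) - arc_val c x a - c (Ed x a) - c (Ed (- x) (- a))"
proof -
  note nx = nx_props[OF x]
  have x': "dadj (- x) (- a)" using x by (simp add: dadj_minus)
  have "bd1 c (x, a) = - c (Ed x a) - c (Ar x a (nx x a)) + c (Ar x (nx x (nx x a)) a)"
    unfolding bd1_eq[OF x] nbrs_other[OF x]
    using nx(6) chain1_Ed[OF c, of a x] chain1_Ar[OF c, of x "nx x a" a] by simp
  moreover have "bd1 c (- x, - a) = - c (Ed (- x) (- a)) - c (Ar (- x) (- a) (- nx x (nx x a)))
      + c (Ar (- x) (- nx x a) (- a))"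
    unfolding bd1_eq[OF x'] nbrs_other[OF x'] nx_minus2[OF x]
    using nx(6) chain1_Ed[OF c, of "- a" "- x"] chain1_Ar[OF c, of "- x" "- nx x (nx x a)" "- a"] by simp
  ultimately show ?thesis by (simp add: arc_val_def nx(2))
qed

lemma sigma_cycle_iff:
  "sigma_cycle c \<longleftrightarrow> chain1 c \<and> (\<forall>x a. dadj x a \<longrightarrow>
     arc_val c x (nx x (nx x a)) = arc_val c x a + c (Ed x a) + c (Ed (- x) (- a)))"
proof (cases "chain1 c")
  case True
  show ?thesis unfolding sigma_cycle_def
    using cycle_arc_val[OF True] True by (smt (verit))
qed (simp add: sigma_cycle_def)

text \<open>Near \<open>a\<close> the pushed-off loop crosses the glued arc that follows
  \<open>b\<close>, near \<open>b\<close> the one that precedes \<open>a\<close>; each crossing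
  contributes an arc value.\<close>

lemma int_edge_arc_val:
  assumes c: "chain1 c" and x: "dadj a b"
  shows "int_edge c (a, b) = arc_val c b (nx b (nx b a)) - arc_val c a b"
proof -
  have x': "dadj b a" using x dadj_sym by blast
  show ?thesis
    unfolding int_edge_def arc_val_def
    using nbrs_other(2)[OF x] nbrs_other(3)[OF x'] nx_props(2)[OF x']
      chain1_Ar[OF c, of a "nx a b" b] chain1_Ar[OF c, of b "nx b (nx b a)" a]
      chain1_Ar[OF c, of "- b" "- a" "- nx b (nx b a)"]
    by simp
qed

definition zgrow :: "zvec list \<Rightarrow> zvec list" where
  "zgrow S = filter (\<lambda>p. list_ex (\<lambda>q. q = p \<or> zadj q p) S) VL"

lemma connected_Vert:
  assumes t: "\<And>x a. dadj x a \<Longrightarrow> t x = t a" and x: "x \<in> Vert" and y: "y \<in> Vert"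
  shows "t x = t y"
proof -
  let ?P = "\<lambda>S. set S \<subseteq> set VL \<and> (\<forall>p\<in>set S. t (ev p) = t (ev (VL ! 0)))"
  have grow: "?P (zgrow S)" if S: "?P S" for S
  proof -
    have "t (ev p) = t (ev (VL ! 0))" if p: "p \<in> set (zgrow S)" for p
    proof -
      obtain q where q: "q \<in> set S" "q = p \<or> zadj q p" "p \<in> set VL"
        using p unfolding zgrow_def set_filter list_ex_iff by blast
      then have "q \<in> set VL" using S by blast
      then have "t (ev q) = t (ev p)" using q t dadj_ev by blast
      then show ?thesis using q(1) S by simp
    qed
    moreover have "set (zgrow S) \<subseteq> set VL" by (simp add: zgrow_def)
    ultimately show ?thesis by blast
  qed
  have "?P [VL ! 0]" by (simp add: VL_def)
  \<comment> \<open>Five rounds reach every vertex, since the dodecahedral graph has diameter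
    5.\<close>
  then have "?P (zgrow (zgrow (zgrow (zgrow (zgrow [VL ! 0])))))" by (intro grow)
  also have "zgrow (zgrow (zgrow (zgrow (zgrow [VL ! 0])))) = VL" by code_simp
  finally have "\<forall>z\<in>Vert. t z = t (ev (VL ! 0))" by (simp add: Vert_eq)
  then show ?thesis using x y by simp
qed

lemma arcs1_cases:
  assumes "\<sigma> \<in> arcs1"
  obtains x a where "dadj x a" "\<sigma> = Ar x a (nx x a)" | x a where "dadj x a" "\<sigma> = Ar x (nx x a) a"
proof -
  obtain x a b where s: "\<sigma> = Ar x a b" "dadj x a" "dadj x b" "b \<noteq> a"
    using assms by (auto simp: arcs1_def)
  then have "b = nx x a \<or> b = nx x (nx x a)" using nbrs_other(1)[OF s(2)] by blast
  then show thesis using that s nx_props(2)[OF s(2)] by metis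
qed

lemma sigma_null_criterion:
  assumes cyc: "sigma_cycle c" and trc: "\<And>x. x \<in> Vert \<Longrightarrow> int_trc c x = 0"
    and edge: "\<And>y. y \<in> oedges \<Longrightarrow> int_edge c y = 0"
  shows "sigma_null c"
proof -
  have c: "chain1 c" using cyc by (simp add: sigma_cycle_def)
  obtain n where n0: "\<And>S. S \<notin> Pents \<Longrightarrow> n S = 0"
    and n: "\<And>x a. dadj x a \<Longrightarrow> c (Ed x a) = n (lf x a) - n (lf a x)"
    using edge_part_exact[OF c trc] by blast
  \<comment> \<open>The arc value of what remains of \<open>c\<close> after subtracting the face
    boundaries; the signs come from \<open>face_sum_Ar\<close>.\<close>
  define t where "t x a = arc_val c x a + n (lf x a) - n (lf (- x) (- nx x a))" for x a
  \<comment> \<open>The cycle condition makes \<open>t\<close> constant around a vertex; in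
    \<open>across\<close>, the vanishing of \<open>int_edge\<close> carries its value along an
    edge.\<close>
  have rot: "t x (nx x (nx x a)) = t x a" if x: "dadj x a" for x a
  proof -
    have x': "dadj (- x) (- a)" using x by (simp add: dadj_minus)
    have "lf (- a) (- x) = lf (- x) (- nx x a)"
      using lf_rev[OF x'] nx_minus2[OF x] by simp
    then have "c (Ed (- x) (- a)) = n (lf (- x) (- a)) - n (lf (- x) (- nx x a))"
      using n[OF x'] by simp
    moreover have "c (Ed x a) = n (lf x a) - n (lf x (nx x (nx x a)))"
      using n[OF x] lf_rev[OF x] by simp
    ultimately show ?thesis
      using cyc x nx_props(2)[OF x] unfolding sigma_cycle_iff t_def by simp
  qed
  have across: "t a b = t b (nx b (nx b a))" if ab: "dadj a b" for a b
  proof -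
    have ba: "dadj b a" using ab dadj_sym by blast
    have "lf a b = lf b (nx b (nx b a))" using lf_rev[OF ba] .
    moreover have "lf (- b) (- a) = lf (- a) (- nx a b)"
      using lf_rot[of "- a" "- nx a b"] nx_minus[OF ab] nx_props(7)[OF ab] by (simp add: dadj_minus)
    moreover have "int_edge c (a, b) = 0" using edge ab by (simp add: oedges_def)
    ultimately show ?thesis
      using int_edge_arc_val[OF c ab] nx_props(2)[OF ba] unfolding t_def by simp
  qed
  have same: "t x b = t x a" if "dadj x a" "dadj x b" for x a b
  proof -
    have "b = a \<or> b = nx x a \<or> b = nx x (nx x a)"
      using that(2) nx_props(1)[OF that(1)] by (simp add: set_eq_iff)
    moreover have "t x (nx x a) = t x a"
      using rot[OF nx_props(7)[OF that(1)]] nx_props(2)[OF that(1)] by simp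
    ultimately show ?thesis using rot[OF that(1)] by metis
  qed
  define s where "s x = t x (SOME a. dadj x a)" for x
  have s: "t x a = s x" if "dadj x a" for x a
    using same[OF that] someI[of "dadj x", OF that] unfolding s_def by metis
  have "s a = s b" if "dadj a b" for a b
  proof -
    have "dadj b a" using that dadj_sym by blast
    then show ?thesis using across[OF that] s that nx_props(8) by metis
  qed
  then have const: "s x = s y" if "x \<in> Vert" "y \<in> Vert" for x y
    using connected_Vert that by blast
  \<comment> \<open>Passing to \<open>- x\<close> negates \<open>t\<close>, because the gluing
    reverses the sense of the arcs; the common value is therefore its own negative.\<close>
  have zero: "t x a = 0" if x: "dadj x a" for x a
  proof -
    have x': "dadj (- x) (- nx x a)" using nx_props(7)[OF x] by (simp add: dadj_minus)
    have "arc_val c (- x) (- nx x a) = - arc_val c x a"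
      unfolding arc_val_def nx_minus[OF x] by simp
    then have "t (- x) (- nx x a) = - t x a" unfolding t_def nx_minus[OF x] by simp
    moreover have "s (- x) = s x"
      using const[of "- x" x] dadj_Vert(1)[OF x] Vert_minus by blast
    ultimately show ?thesis using s[OF x] s[OF x'] by simp
  qed
  define r where "r \<sigma> = c \<sigma> - (\<Sum>S\<in>dfaces. n S * face_bd S \<sigma>)" for \<sigma>
  have "r (Ed x a) = 0" if "dadj x a" for x a
    unfolding r_def using face_sum_Ed[OF n0 that] n[OF that] by simp
  moreover have "r \<sigma> + r (antip1 \<sigma>) = 0" if "\<sigma> \<in> arcs1" for \<sigma>
    using that
  proof (cases rule: arcs1_cases)
    case (1 x a)
    have x': "dadj (- x) (- nx x a)" using nx_props(7)[OF 1(1)] by (simp add: dadj_minus)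
    show ?thesis
      using zero[OF 1(1)] face_sum_Ar[OF n0 1(1)] face_sum_Ar[OF n0 x']
        chain1_Ar[OF c, of "- x" "- nx x a" "- a"]
      unfolding 1(2) r_def t_def arc_val_def nx_minus[OF 1(1)] by simp
  next
    case (2 x a)
    have x': "dadj (- x) (- nx x a)" using nx_props(7)[OF 2(1)] by (simp add: dadj_minus)
    show ?thesis
      using zero[OF 2(1)] face_sum_Ar[OF n0 2(1)] face_sum_Ar[OF n0 x']
        chain1_Ar[OF c, of x "nx x a" a]
      unfolding 2(2) r_def t_def arc_val_def nx_minus[OF 2(1)] by simp
  qed
  ultimately show ?thesis unfolding sigma_null_def Let_def r_def by blast
qed

subsection \<open>Equivariance\<close>

lemma Igrp_inner: "g \<in> Igrp \<Longrightarrow> (g *v x) \<bullet> (g *v y) = x \<bullet> y"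
  by (simp add: Igrp_def rotation_matrix_def orthogonal_matrix dot_matrix_product[symmetric]
      flip: dot_lmul_matrix vector_transpose_matrix)
     (metis dot_lmul_matrix matrix_vector_mul_assoc matrix_vector_mul_lid transpose_transpose vector_transpose_matrix)

lemma Igrp_inv:
  assumes "g \<in> Igrp"
  shows "matrix_inv g *v (g *v x) = x" "g *v (matrix_inv g *v x) = x" "matrix_inv g \<in> Igrp"
proof -
  have o: "transpose g ** g = mat 1" "g ** transpose g = mat 1" and d: "det g = 1"
    and V: "(\<lambda>v. g *v v) ` Vert = Vert"
    using assms by (simp_all add: Igrp_def rotation_matrix_def orthogonal_matrix_def)
  have inv: "g ** matrix_inv g = mat 1 \<and> matrix_inv g ** g = mat 1"
    unfolding matrix_inv_def by (rule someI[of _ "transpose g"]) (use o in simp)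
  then have "matrix_inv g = transpose g"
    using o by (metis matrix_mul_assoc matrix_mul_lid matrix_mul_rid)
  then have r: "rotation_matrix (matrix_inv g)"
    using o d by (simp add: rotation_matrix_def orthogonal_matrix_def det_transpose)
  show 1: "matrix_inv g *v (g *v x) = x" "g *v (matrix_inv g *v x) = x" for x
    using inv by (simp_all add: matrix_vector_mul_assoc)
  have "(\<lambda>v. matrix_inv g *v v) ` Vert = (\<lambda>v. matrix_inv g *v v) ` (\<lambda>v. g *v v) ` Vert"
    using V by simp
  then have "(\<lambda>v. matrix_inv g *v v) ` Vert = Vert" by (simp add: image_image 1)
  with r show "matrix_inv g \<in> Igrp" by (simp add: Igrp_def)
qed

lemma Igrp_eq_iff: "g \<in> Igrp \<Longrightarrow> g *v x = g *v y \<longleftrightarrow> x = y"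
  using Igrp_inv(1) by metis

lemma Igrp_Vert:
  assumes "g \<in> Igrp"
  shows "g *v x \<in> Vert \<longleftrightarrow> x \<in> Vert"
proof -
  have "g' *v x \<in> Vert" if "g' \<in> Igrp" "x \<in> Vert" for g' x using that by (auto simp: Igrp_def)
  from this[of g x] this[of "matrix_inv g" "g *v x"] show ?thesis
    using assms Igrp_inv by metis
qed

lemma Igrp_dadj: "g \<in> Igrp \<Longrightarrow> dadj (g *v x) (g *v a) \<longleftrightarrow> dadj x a"
  by (simp add: dadj_iff Igrp_Vert Igrp_inner)

lemma Igrp_ccw: "g \<in> Igrp \<Longrightarrow> ccw (g *v x) (g *v a) (g *v b) \<longleftrightarrow> ccw x a b"
  using cross_rotation_matrix[of g] by (simp add: ccw_iff Igrp_inner) (simp add: Igrp_def Igrp_inner)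

lemma Igrp_minus: "g *v (- x) = - (g *v x)" for g :: "real^3^3"
  using matrix_vector_mult_diff_distrib[of g 0 x] by simp

lemma Igrp_nx:
  assumes g: "g \<in> Igrp" and x: "dadj x a"
  shows "nx (g *v x) (g *v a) = g *v nx x a"
proof -
  have "ccw x a (nx x a)" "dadj x (nx x a)" using nx_props(3,7)[OF x] by blast+
  then have "ccw (g *v x) (g *v a) (g *v nx x a)" "dadj (g *v x) (g *v nx x a)" "dadj (g *v x) (g *v a)"
    using g x by (simp_all add: Igrp_ccw Igrp_dadj)
  then show ?thesis using nx_props(3) by metis
qed

lemma Igrp_nbrs:
  assumes "g \<in> Igrp"
  shows "{b. dadj (g *v x) b} = (\<lambda>v. g *v v) ` {a. dadj x a}"
proof (intro equalityI subsetI)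
  fix b assume "b \<in> {b. dadj (g *v x) b}"
  then have "dadj x (matrix_inv g *v b)" using Igrp_dadj[OF assms, of x "matrix_inv g *v b"] assms
    by (simp add: Igrp_inv)
  then show "b \<in> (\<lambda>v. g *v v) ` {a. dadj x a}"
    using Igrp_inv(2)[OF assms, of b] by (metis (mono_tags) imageI mem_Collect_eq)
qed (use Igrp_dadj[OF assms] in auto)

lemma chain1_act:
  assumes g: "g \<in> Igrp" and c: "chain1 c"
  shows "chain1 (act_chain g c)"
proof -
  let ?h = "matrix_inv g"
  have h: "?h \<in> Igrp" using Igrp_inv(3)[OF g] .
  have "act_cell ?h \<sigma> \<in> cells1 \<longleftrightarrow> \<sigma> \<in> cells1" for \<sigma>
    using h by (cases \<sigma>) (auto simp: cells1_def Igrp_dadj Igrp_eq_iff)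
  moreover have "act_cell ?h (rev1 \<sigma>) = rev1 (act_cell ?h \<sigma>)" for \<sigma> by (cases \<sigma>) auto
  ultimately show ?thesis using c by (simp add: chain1_def act_chain_def)
qed

lemma act_chain_cell: "g \<in> Igrp \<Longrightarrow> act_chain g c (act_cell g \<sigma>) = c \<sigma>"
  by (cases \<sigma>) (simp_all add: act_chain_def Igrp_inv)

lemma act_chain_Ed: "g \<in> Igrp \<Longrightarrow> act_chain g c (Ed (g *v x) (g *v a)) = c (Ed x a)"
  using act_chain_cell[of g c "Ed x a"] by simp

lemma act_chain_Ar: "g \<in> Igrp \<Longrightarrow> act_chain g c (Ar (g *v x) (g *v a) (g *v b)) = c (Ar x a b)"
  using act_chain_cell[of g c "Ar x a b"] by simp

lemma int_trc_act:
  assumes "g \<in> Igrp"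
  shows "int_trc (act_chain g c) (g *v x) = int_trc c x"
  unfolding int_trc_def Igrp_nbrs[OF assms]
  using Igrp_eq_iff[OF assms] by (subst sum.reindex) (auto simp: inj_on_def act_chain_Ed[OF assms])

lemma arc_val_act:
  assumes "g \<in> Igrp" "dadj x a"
  shows "arc_val (act_chain g c) (g *v x) (g *v a) = arc_val c x a"
  unfolding arc_val_def Igrp_nx[OF assms] Igrp_minus[symmetric] act_chain_Ar[OF assms(1)] ..

lemma int_edge_act:
  assumes g: "g \<in> Igrp" and c: "chain1 c" and ab: "dadj a b"
  shows "int_edge (act_chain g c) (g *v a, g *v b) = int_edge c (a, b)"
proof -
  have ba: "dadj b a" using ab dadj_sym by blast
  have "int_edge (act_chain g c) (g *v a, g *v b) =
      arc_val (act_chain g c) (g *v b) (g *v nx b (nx b a)) - arc_val (act_chain g c) (g *v a) (g *v b)"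
    using int_edge_arc_val[OF chain1_act[OF g c], of "g *v a" "g *v b"] ab g nx_props(7)[OF ba]
    by (simp add: Igrp_dadj Igrp_nx ba)
  also have "\<dots> = int_edge c (a, b)"
    using int_edge_arc_val[OF c ab] arc_val_act[OF g ab] arc_val_act[OF g nx_props(8)[OF ba]] by simp
  finally show ?thesis .
qed

lemma sigma_cycle_act:
  assumes g: "g \<in> Igrp" and c: "sigma_cycle c"
  shows "sigma_cycle (act_chain g c)"
  unfolding sigma_cycle_iff
proof (intro conjI allI impI)
  show "chain1 (act_chain g c)" using chain1_act[OF g] c by (simp add: sigma_cycle_def)
  fix x a assume xa: "dadj x a"
  define x' a' where "x' = matrix_inv g *v x" and "a' = matrix_inv g *v a"
  have x: "x = g *v x'" and a: "a = g *v a'" using Igrp_inv(2)[OF g] by (simp_all add: x'_def a'_def)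
  have xa': "dadj x' a'" using xa g by (simp add: x a Igrp_dadj)
  show "arc_val (act_chain g c) x (nx x (nx x a)) =
      arc_val (act_chain g c) x a + act_chain g c (Ed x a) + act_chain g c (Ed (- x) (- a))"
    using c xa' nx_props(7,8)[OF xa'] unfolding sigma_cycle_iff x a
    by (simp add: Igrp_nx[OF g] arc_val_act[OF g] act_chain_Ed[OF g] flip: Igrp_minus)
qed

section \<open>Linearity of the pairings and the criterion for homomorphisms\<close>

lemma arc_val_linear:
  "arc_val (\<lambda>\<sigma>. c \<sigma> - d \<sigma>) x a = arc_val c x a - arc_val d x a"
  "arc_val (\<lambda>\<sigma>. m * c \<sigma>) x a = m * arc_val c x a"
  "arc_val (\<lambda>\<sigma>. \<Sum>k\<in>K. u k \<sigma>) x a = (\<Sum>k\<in>K. arc_val (u k) x a)"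
  by (simp_all add: arc_val_def right_diff_distrib sum_subtractf)

lemma sigma_cycle_diff:
  "sigma_cycle c \<Longrightarrow> sigma_cycle d \<Longrightarrow> sigma_cycle (\<lambda>\<sigma>. c \<sigma> - d \<sigma>)"
  unfolding sigma_cycle_iff arc_val_linear by (simp add: chain1_def)

lemma sigma_cycle_scale: "sigma_cycle c \<Longrightarrow> sigma_cycle (\<lambda>\<sigma>. m * c \<sigma>)"
  unfolding sigma_cycle_iff arc_val_linear by (simp add: chain1_def distrib_left)

lemma sigma_cycle_sum:
  "(\<And>k. k \<in> K \<Longrightarrow> sigma_cycle (c k)) \<Longrightarrow> sigma_cycle (\<lambda>\<sigma>. \<Sum>k\<in>K. c k \<sigma>)"
  unfolding sigma_cycle_iff arc_val_linear by (simp add: chain1_def sum_negf sum.distrib)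

lemma int_trc_linear:
  "int_trc (\<lambda>\<sigma>. c \<sigma> - d \<sigma>) x = int_trc c x - int_trc d x"
  "int_trc (\<lambda>\<sigma>. m * c \<sigma>) x = m * int_trc c x"
  "int_trc (\<lambda>\<sigma>. \<Sum>k\<in>K. u k \<sigma>) x = (\<Sum>k\<in>K. int_trc (u k) x)"
  by (simp_all add: int_trc_def sum_subtractf sum_distrib_left sum.swap[of _ K])

lemma int_edge_linear:
  "int_edge (\<lambda>\<sigma>. c \<sigma> - d \<sigma>) y = int_edge c y - int_edge d y"
  "int_edge (\<lambda>\<sigma>. m * c \<sigma>) y = m * int_edge c y"
  "int_edge (\<lambda>\<sigma>. \<Sum>k\<in>K. u k \<sigma>) y = (\<Sum>k\<in>K. int_edge (u k) y)"
  by (cases y; simp add: int_edge_def sum_subtractf sum.distrib right_diff_distrib distrib_left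
      sum_distrib_left sum.swap[of _ K])+

lemma act_cube_Cubes:
  assumes g: "g \<in> Igrp" and k: "k \<in> Cubes"
  shows "act_cube g k \<in> Cubes"
proof -
  obtain c u v w where o: "u \<bullet> v = 0" "v \<bullet> w = 0" "u \<bullet> w = 0" "u \<noteq> 0" "norm u = norm v" "norm v = norm w"
    and S: "k = {c + s1 *\<^sub>R u + s2 *\<^sub>R v + s3 *\<^sub>R w | s1 s2 s3.
      s1 \<in> {-1,1} \<and> s2 \<in> {-1,1} \<and> s3 \<in> {-1,1}}" and V: "k \<subseteq> Vert"
    using k by (auto simp: Cubes_def is_cube_def)
  have "act_cube g k = {g *v c + s1 *\<^sub>R (g *v u) + s2 *\<^sub>R (g *v v) + s3 *\<^sub>R (g *v w) | s1 s2 s3.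
      s1 \<in> {-1,1} \<and> s2 \<in> {-1,1} \<and> s3 \<in> {-1,1}}"
    unfolding act_cube_def S sgn_triples
    by (simp add: matrix_vector_right_distrib matrix_vector_mult_diff_distrib)
  moreover have nm: "norm (g *v x) = norm x" for x using Igrp_inner[OF g] by (simp add: norm_eq_sqrt_inner)
  moreover have "g *v u \<noteq> 0" using Igrp_eq_iff[OF g, of u 0] o(4) by simp
  ultimately have "is_cube (act_cube g k)"
    unfolding is_cube_def
    by (intro exI[of _ "g *v c"] exI[of _ "g *v u"] exI[of _ "g *v v"] exI[of _ "g *v w"] conjI)
       (simp_all add: o nm Igrp_inner[OF g])
  moreover have "act_cube g k \<subseteq> Vert" using V Igrp_Vert[OF g] by (auto simp: act_cube_def)
  ultimately show ?thesis by (simp add: Cubes_def)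
qed

text \<open>\<open>T\<close> and \<open>E\<close> prescribe the pairings with the two lattices. Each
  relation required of \<open>u\<close> asks that some cycle be null-homologous, and these tables
  show that all its pairings vanish.\<close>

lemma hom_VH_criterion:
  assumes cyc: "\<And>k. k \<in> Cubes \<Longrightarrow> sigma_cycle (u k)"
    and T: "\<And>k x. k \<in> Cubes \<Longrightarrow> x \<in> Vert \<Longrightarrow> int_trc (u k) x = T k x"
    and E: "\<And>k a b. k \<in> Cubes \<Longrightarrow> dadj a b \<Longrightarrow> int_edge (u k) (a, b) = E k a b"
    and sum: "\<And>x. x \<in> Vert \<Longrightarrow> (\<Sum>k\<in>Cubes. T k x) = 0" "\<And>a b. dadj a b \<Longrightarrow> (\<Sum>k\<in>Cubes. E k a b) = 0"
    and inv: "\<And>g k x. g \<in> Igrp \<Longrightarrow> k \<in> Cubes \<Longrightarrow> x \<in> Vert \<Longrightarrow> T (act_cube g k) (g *v x) = T k x"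
      "\<And>g k a b. g \<in> Igrp \<Longrightarrow> k \<in> Cubes \<Longrightarrow> dadj a b \<Longrightarrow> E (act_cube g k) (g *v a) (g *v b) = E k a b"
  shows "hom_VH u"
  unfolding hom_VH_def
proof (intro conjI ballI)
  show "sigma_cycle (u k)" if "k \<in> Cubes" for k using cyc[OF that] .
  show "sigma_null (\<lambda>\<sigma>. \<Sum>k\<in>Cubes. u k \<sigma>)"
    by (rule sigma_null_criterion)
       (auto simp: int_trc_linear int_edge_linear sigma_cycle_sum cyc T E sum oedges_def)
  fix g k assume g: "g \<in> Igrp" and k: "k \<in> Cubes"
  have k': "act_cube g k \<in> Cubes" using act_cube_Cubes[OF g k] .
  have c: "chain1 (u k)" using cyc[OF k] by (simp add: sigma_cycle_def)
  show "sigma_null (\<lambda>\<sigma>. u (act_cube g k) \<sigma> - act_chain g (u k) \<sigma>)"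
  proof (rule sigma_null_criterion)
    show "sigma_cycle (\<lambda>\<sigma>. u (act_cube g k) \<sigma> - act_chain g (u k) \<sigma>)"
      by (intro sigma_cycle_diff sigma_cycle_act cyc k k' g)
    show "int_trc (\<lambda>\<sigma>. u (act_cube g k) \<sigma> - act_chain g (u k) \<sigma>) x = 0" if "x \<in> Vert" for x
    proof -
      define x' where "x' = matrix_inv g *v x"
      have x: "x = g *v x'" using Igrp_inv(2)[OF g] by (simp add: x'_def)
      then have "x' \<in> Vert" using that Igrp_Vert[OF g] by simp
      then show ?thesis
        using T[OF k'] T[OF k] inv(1)[OF g k] that unfolding x int_trc_linear int_trc_act[OF g] by simp
    qed
    show "int_edge (\<lambda>\<sigma>. u (act_cube g k) \<sigma> - act_chain g (u k) \<sigma>) y = 0" if y: "y \<in> oedges" for y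
    proof -
      obtain a b where ab: "y = (a, b)" "dadj a b" using y by (auto simp: oedges_def)
      define a' b' where "a' = matrix_inv g *v a" and "b' = matrix_inv g *v b"
      have x: "a = g *v a'" "b = g *v b'" using Igrp_inv(2)[OF g] by (simp_all add: a'_def b'_def)
      then have "dadj a' b'" using ab Igrp_dadj[OF g] by simp
      then show ?thesis
        using E[OF k'] E[OF k] inv(2)[OF g k] ab
        unfolding ab(1) x int_edge_linear by (simp add: int_edge_act[OF g c])
    qed
  qed
qed

subsection \<open>Rotations and inscribed cubes\<close>

type_synonym zmat = "zvec \<times> zvec \<times> zvec"

fun zmact :: "zmat \<Rightarrow> zvec \<Rightarrow> zvec" where
  "zmact (r1, r2, r3) p = (zdot r1 p, zdot r2 p, zdot r3 p)"

abbreviation zdouble :: "zvec \<Rightarrow> zvec" where "zdouble \<equiv> zscale (2,0)"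

text \<open>Integer entries represent twice the matrix, since rotations of the dodecahedron have
  entries in \<open>\<int>[\<phi>]/2\<close>.\<close>
fun mat_of :: "zmat \<Rightarrow> real^3^3" where
  "mat_of (r1, r2, r3) = vector [(1/2) *\<^sub>R ev r1, (1/2) *\<^sub>R ev r2, (1/2) *\<^sub>R ev r3]"

text \<open>The entries are doubled, so rows have squared norm 4, the determinant is 8, and images
  are compared with doubled vertices.\<close>

fun zrot :: "zmat \<Rightarrow> bool" where
  "zrot (r1, r2, r3) \<longleftrightarrow> zdot r1 r1 = (4,0) \<and> zdot r2 r2 = (4,0) \<and> zdot r3 r3 = (4,0) \<and>
     zdot r1 r2 = (0,0) \<and> zdot r1 r3 = (0,0) \<and> zdot r2 r3 = (0,0) \<and> zdet r1 r2 r3 = (8,0) \<and>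
     list_all (\<lambda>p. list_ex (\<lambda>q. zmact (r1, r2, r3) p = zdouble q) VL) VL"

lemma mat_of_zmact:
  assumes "zmact M p = zdouble q"
  shows "mat_of M *v ev p = ev q"
proof -
  obtain r1 r2 r3 where M: "M = (r1, r2, r3)" by (cases M)
  have "ev (zmact M p) = 2 *\<^sub>R ev q" unfolding assms ev_zscale by (simp add: zv_def)
  then have "zv (zdot r1 p) = 2 * ev q $ 1" "zv (zdot r2 p) = 2 * ev q $ 2" "zv (zdot r3 p) = 2 * ev q $ 3"
    by (simp_all add: M vec3_eq_iff ev_nth)
  then show ?thesis
    by (simp add: vec3_eq_iff matrix_vector_mul_component M ev_zdot)
qed

lemma zrot_Igrp:
  assumes "zrot M"
  shows "mat_of M \<in> Igrp"
proof -
  obtain r1 r2 r3 where M: "M = (r1, r2, r3)" by (cases M)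
  have d: "ev r1 \<bullet> ev r1 = 4" "ev r2 \<bullet> ev r2 = 4" "ev r3 \<bullet> ev r3 = 4"
    "ev r1 \<bullet> ev r2 = 0" "ev r1 \<bullet> ev r3 = 0" "ev r2 \<bullet> ev r3 = 0"
    "cross3 (ev r1) (ev r2) \<bullet> ev r3 = 8"
    using assms by (simp_all add: M ev_zdot ev_zdet) (simp_all add: zv_def)
  have row: "row i (mat_of M) = mat_of M $ i" for i by (simp add: row_def)
  have "orthogonal_matrix (mat_of M)"
    unfolding orthogonal_matrix_orthonormal_rows row
    using d by (simp add: M forall_3 orthogonal_def norm_eq_sqrt_inner inner_commute)
  moreover have "det (mat_of M) = (cross3 (ev r1) (ev r2) \<bullet> ev r3) / 8"
    by (simp add: M det_3 inner3 cross3_nth algebra_simps)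
  ultimately have rot: "rotation_matrix (mat_of M)" using d by (simp add: rotation_matrix_def)
  have "list_all (\<lambda>p. list_ex (\<lambda>q. zmact M p = zdouble q) VL) VL" using assms by (simp add: M)
  then have "mat_of M *v x \<in> Vert" if "x \<in> Vert" for x
    using that mat_of_zmact[of M] unfolding Vert_eq list_all_iff list_ex_iff by blast
  then have sub: "(\<lambda>v. mat_of M *v v) ` Vert \<subseteq> Vert" by blast
  \<comment> \<open>Orthogonality makes the map injective, and an injective self-map of the finite
    set \<open>Vert\<close> is onto.\<close>
  have "transpose (mat_of M) ** mat_of M = mat 1"
    using rot by (simp add: rotation_matrix_def orthogonal_matrix)
  then have "inj ((*v) (mat_of M))"
    by (intro inj_on_inverseI[where g = "(*v) (transpose (mat_of M))"])
       (simp add: matrix_vector_mul_assoc)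
  then have "inj_on (\<lambda>v. mat_of M *v v) Vert" by (rule inj_on_subset) simp
  then have "(\<lambda>v. mat_of M *v v) ` Vert = Vert" using endo_inj_surj[OF finite_Vert sub] by blast
  with rot show ?thesis by (simp add: Igrp_def)
qed

definition K0L :: "zvec list" where "K0L = take 4 VL @ drop 16 VL"

definition k0 :: "(real^3) set" where "k0 = ev ` set K0L"

text \<open>The rotations preserving the cube with vertices \<open>(\<plusminus>1,\<plusminus>1,\<plusminus>1)\<close>.\<close>
definition AL :: "zmat list" where
  "AL = concat (map (\<lambda>(r1, r2, r3). [(r1, r2, r3), (r1, zneg r2, zneg r3),
      (zneg r1, r2, zneg r3), (zneg r1, zneg r2, r3)])
    (let e1 = ((2,0),(0,0),(0,0)); e2 = ((0,0),(2,0),(0,0)); e3 = ((0,0),(0,0),(2,0))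
     in [(e1, e2, e3), (e2, e3, e1), (e3, e1, e2)]))"

text \<open>The half turn about u is 2 u u^T / |u|^2 - 1. For |u| = 2, as for the axes in
  \<open>CL\<close>, its double is u u^T - 2.\<close>

fun halfturn :: "zvec \<Rightarrow> zmat" where
  "halfturn (x, y, z) = (zvadd (zscale x (x, y, z)) ((-2,0),(0,0),(0,0)),
     zvadd (zscale y (x, y, z)) ((0,0),(-2,0),(0,0)), zvadd (zscale z (x, y, z)) ((0,0),(0,0),(-2,0)))"

text \<open>Half turns about edge midpoints that carry the standard cube to the four other cubes,
  and a half turn about a coordinate axis, which preserves it.\<close>
definition CL :: "zmat list" where
  "CL = map halfturn [((2,0),(0,0),(0,0)), ((1,0),(0,1),(-1,1)), ((-1,0),(0,1),(-1,1)),
     ((1,0),(0,-1),(-1,1)), ((1,0),(0,1),(1,-1))]"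

lemma AL_CL_rot: "list_all zrot AL" "list_all zrot CL"
  by code_simp+

text \<open>Undoes the doubling; \<open>cube_lists_eq\<close> checks that the division is exact
  where it is applied.\<close>

fun zhalf :: "zvec \<Rightarrow> zvec" where
  "zhalf ((a,b),(c,d),(e,f)) = ((a div 2,b div 2),(c div 2,d div 2),(e div 2,f div 2))"

definition cube_lists :: "zvec list list" where
  "cube_lists = map (\<lambda>M. map (\<lambda>p. zhalf (zmact M p)) K0L) CL"

lemma cube_lists_eq:
  "list_all (\<lambda>M. list_all (\<lambda>p. zmact M p = zdouble (zhalf (zmact M p))) K0L) CL"
  by code_simp

text \<open>A cube centred at 0 with half-axes u, v, w is recovered from p = -u+v+w, q = u-v+w and r
  = u+v-w, because p+q+r = u+v+w.\<close>

definition cube_pts :: "zvec \<Rightarrow> zvec \<Rightarrow> zvec \<Rightarrow> zvec list" where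
  "cube_pts p q r = (let s = zvadd p (zvadd q r) in
     [zneg s, zneg r, zneg q, p, zneg p, q, r, s])"

definition cube_check :: "zvec list list \<Rightarrow> zvec \<Rightarrow> zvec \<Rightarrow> zvec \<Rightarrow> bool" where
  "cube_check Ls p q r \<longleftrightarrow> list_ex (\<lambda>L. if p \<in> set L then if q \<in> set L then
     list_all (\<lambda>t. t \<in> set L) (cube_pts p q r) \<and> list_all (\<lambda>t. t \<in> set (cube_pts p q r)) L
     else False else False) Ls"

text \<open>For half-axes of length 1, the three vertices passed to \<open>cube_pts\<close> have
  pairwise inner product -1, so every inscribed cube arises from such a triple.\<close>

definition triples_check :: "zvec list list \<Rightarrow> bool" where
  "triples_check Ls \<longleftrightarrow> list_all (\<lambda>p. list_all (\<lambda>q. list_all (\<lambda>r. cube_check Ls p q r)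
     (filter (\<lambda>r. zdot p r = (-1,0) \<and> zdot q r = (-1,0)) VL))
     (filter (\<lambda>q. zdot p q = (-1,0)) VL)) VL"

lemma cubes_check: "triples_check cube_lists"
  by code_simp

lemma k0_Vert: "k0 \<subseteq> Vert"
  unfolding k0_def Vert_eq K0L_def by (auto dest: in_set_takeD in_set_dropD)

lemma k0_Cubes: "k0 \<in> Cubes"
proof -
  let ?u = "vector [1,0,0] :: real^3" and ?v = "vector [0,1,0] :: real^3" and ?w = "vector [0,0,1] :: real^3"
  have vec: "0 + s1 *\<^sub>R ?u + s2 *\<^sub>R ?v + s3 *\<^sub>R ?w = vector [s1, s2, s3]" for s1 s2 s3
    by (simp add: vec3_eq_iff)
  have "k0 = {vector [s1, s2, s3] | s1 s2 s3. s1 \<in> {-1,1} \<and> s2 \<in> {-1,1} \<and> s3 \<in> {-1,1}}"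
    unfolding sgn_triples by (simp add: k0_def K0L_def VL_def ev_def zv_consts insert_commute)
  then have "is_cube k0"
    unfolding is_cube_def
    by (intro exI[of _ 0] exI[of _ ?u] exI[of _ ?v] exI[of _ ?w] conjI, unfold vec)
       (simp_all add: inner3 norm_eq_sqrt_inner vec3_eq_iff)
  then show ?thesis using k0_Vert by (simp add: Cubes_def)
qed

lemma four_orthogonal:
  fixes c u v w :: "real^3"
  assumes "c \<bullet> u = 0" "c \<bullet> v = 0" "c \<bullet> w = 0" "u \<bullet> v = 0" "u \<bullet> w = 0" "v \<bullet> w = 0"
    and "u \<noteq> 0" "v \<noteq> 0" "w \<noteq> 0"
  shows "c = 0"
proof (rule ccontr)
  assume "c \<noteq> 0"
  have ne: "c \<noteq> u" "c \<noteq> v" "c \<noteq> w" "u \<noteq> v" "u \<noteq> w" "v \<noteq> w" using assms by auto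
  have "pairwise orthogonal {c,u,v,w}"
    using assms by (auto simp: pairwise_insert orthogonal_def inner_commute)
  then have "independent {c,u,v,w}"
    using pairwise_orthogonal_independent assms \<open>c \<noteq> 0\<close> by blast
  then have "card {c,u,v,w} \<le> 3" using independent_card_le[of "{c,u,v,w}"] by simp
  then show False using ne by simp
qed

text \<open>Turns an equation of reals into one of pairs: every other inner product of vertices is
  strictly separated from -1.\<close>

lemma zv_dot_VL:
  assumes "p \<in> set VL" "q \<in> set VL" "ev p \<bullet> ev q = -1"
  shows "zdot p q = (-1,0)"
proof -
  have "list_all (\<lambda>p. list_all (\<lambda>q. zdot p q = (-1,0) \<or> zpos (zsub (-1,0) (zdot p q)) \<or>
      zpos (zsub (zdot p q) (-1,0))) VL) VL"
    by code_simp
  then have "zdot p q = (-1,0) \<or> zpos (zsub (-1,0) (zdot p q)) \<or> zpos (zsub (zdot p q) (-1,0))"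
    using assms unfolding list_all_iff by blast
  then show ?thesis using assms(3) by (auto simp: zpos_iff zv_simps zv_consts ev_zdot)
qed

text \<open>An inscribed cube is centred at 0 with half-axes of length 1, so three of its vertices
  determine it, and the finite check finds it among the images of the standard cube under
  \<open>CL\<close>.\<close>

lemma cube_transitive:
  assumes "k \<in> Cubes"
  obtains g where "g \<in> Igrp" "k = act_cube g k0"
proof -
  obtain c u v w where o: "u \<bullet> v = 0" "v \<bullet> w = 0" "u \<bullet> w = 0" "u \<noteq> 0"
      and n: "norm u = norm v" "norm v = norm w"
    and "k = {c + s1 *\<^sub>R u + s2 *\<^sub>R v + s3 *\<^sub>R w | s1 s2 s3.
      s1 \<in> {-1,1} \<and> s2 \<in> {-1,1} \<and> s3 \<in> {-1,1}}" and V: "k \<subseteq> Vert"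
    using assms unfolding Cubes_def is_cube_def by blast
  then have S: "k = {c - u - v - w, c - u - v + w, c - u + v - w, c - u + v + w,
      c + u - v - w, c + u - v + w, c + u + v - w, c + u + v + w}"
    unfolding sgn_triples by simp
  have n2: "v \<bullet> v = u \<bullet> u" "w \<bullet> w = u \<bullet> u" using n by (simp_all add: norm_eq_sqrt_inner)
  have "x \<bullet> x = 3" if "x \<in> k" for x using that V inner_Vert_self by blast
  \<comment> \<open>Comparing \<open>c + u + v + w\<close> with its variants by one or three sign
    changes makes \<open>c\<close> orthogonal to all half-axes.\<close>
  then have I: "(c - u - v - w) \<bullet> (c - u - v - w) = 3" "(c + u + v + w) \<bullet> (c + u + v + w) = 3"
     "(c - u + v + w) \<bullet> (c - u + v + w) = 3" "(c + u - v + w) \<bullet> (c + u - v + w) = 3"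
     "(c + u + v - w) \<bullet> (c + u + v - w) = 3"
    unfolding S by blast+
  have cu: "c \<bullet> u = 0" "c \<bullet> v = 0" "c \<bullet> w = 0" and n3: "c \<bullet> c + 3 * (u \<bullet> u) = 3"
    using I by (simp_all add: inner_add_left inner_add_right inner_diff_left inner_diff_right
        o n2 inner_commute[of v u] inner_commute[of w u] inner_commute[of w v]
        inner_commute[of u c] inner_commute[of v c] inner_commute[of w c])
  have "v \<noteq> 0" "w \<noteq> 0" using o(4) n by auto
  then have c: "c = 0" using four_orthogonal[of c u v w] cu o by simp
  with n3 have n3: "u \<bullet> u = 1" by simp
  have "- u + v + w \<in> k" "u - v + w \<in> k" "u + v - w \<in> k"
    unfolding S c by simp_all
  then obtain p q r where p: "p \<in> set VL" "- u + v + w = ev p" and q: "q \<in> set VL" "u - v + w = ev q"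
    and r: "r \<in> set VL" "u + v - w = ev r"
    using V unfolding Vert_eq by (meson imageE subsetD)
  have "ev p \<bullet> ev q = -1" "ev p \<bullet> ev r = -1" "ev q \<bullet> ev r = -1"
    unfolding p(2)[symmetric] q(2)[symmetric] r(2)[symmetric]
    by (simp_all add: inner_add_left inner_add_right inner_diff_left inner_diff_right
        o n2 n3 inner_commute[of v u] inner_commute[of w u] inner_commute[of w v])
  then have dots: "zdot p q = (-1,0)" "zdot p r = (-1,0)" "zdot q r = (-1,0)"
    using zv_dot_VL p q r by blast+
  have "cube_check cube_lists p q r"
    using cubes_check p(1) q(1) r(1) dots unfolding triples_check_def list_all_iff set_filter by blast
  then obtain L where L: "L \<in> set cube_lists" "set L = set (cube_pts p q r)"
    unfolding cube_check_def list_ex_iff list_all_iff by (metis subsetI subset_antisym)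
  have sum: "ev (zvadd p (zvadd q r)) = u + v + w"
    unfolding ev_zvadd p(2)[symmetric] q(2)[symmetric] r(2)[symmetric] by simp
  have "k = ev ` set (cube_pts p q r)"
    unfolding S c by (simp add: cube_pts_def Let_def ev_zneg sum algebra_simps
        flip: p(2) q(2) r(2))
  also have "\<dots> = ev ` set L" using L(2) by simp
  finally have k: "k = ev ` set L" .
  obtain M where M: "M \<in> set CL" "L = map (\<lambda>p. zhalf (zmact M p)) K0L"
    using L(1) by (auto simp: cube_lists_def)
  have "mat_of M *v ev t = ev (zhalf (zmact M t))" if "t \<in> set K0L" for t
    by (rule mat_of_zmact) (use cube_lists_eq M(1) that in \<open>unfold list_all_iff, blast\<close>)
  then have "ev ` set L = (\<lambda>v. mat_of M *v v) ` k0"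
    unfolding M(2) k0_def set_map image_image by (intro image_cong) simp_all
  then have "k = act_cube (mat_of M) k0" by (simp add: k act_cube_def)
  moreover have "mat_of M \<in> Igrp" using AL_CL_rot(2) M(1) zrot_Igrp by (auto simp: list_all_iff)
  ultimately show thesis using that by blast
qed

subsection \<open>Equivariant functions and the two cycles\<close>

definition Tet :: "(real^3) set" where "Tet = ev ` set (take 4 VL)"

text \<open>On vertices this is the function \<open>x\<^sub>1x\<^sub>2x\<^sub>3\<close>.\<close>
definition T0 :: "real^3 \<Rightarrow> int" where
  "T0 x = (if x \<in> Tet then 1 else if - x \<in> Tet then -1 else 0)"

definition zT0 :: "zvec \<Rightarrow> int" where
  "zT0 p = (if p \<in> set (take 4 VL) then 1 else if zneg p \<in> set (take 4 VL) then -1 else 0)"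

lemma zT0_cases: "zT0 p = 1 \<or> zT0 p = -1 \<or> zT0 p = 0"
  by (simp add: zT0_def)

lemma ev_image_iff:
  assumes "p \<in> set VL" "set ps \<subseteq> set VL"
  shows "ev p \<in> ev ` set ps \<longleftrightarrow> p \<in> set ps"
  using inj_on_image_mem_iff[OF inj_ev] assms by blast

lemma zneg_VL: "p \<in> set VL \<Longrightarrow> zneg p \<in> set VL"
proof -
  have "list_all (\<lambda>p. zneg p \<in> set VL) VL" by code_simp
  then show "p \<in> set VL \<Longrightarrow> zneg p \<in> set VL" by (simp add: list_all_iff)
qed

lemma T0_ev: "p \<in> set VL \<Longrightarrow> T0 (ev p) = zT0 p"
  using ev_image_iff[of p "take 4 VL"] ev_image_iff[of "zneg p" "take 4 VL"] zneg_VL[of p]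
  by (simp add: T0_def zT0_def Tet_def ev_zneg[symmetric] set_take_subset)

lemma Tet_disjoint: "x \<in> Tet \<Longrightarrow> - x \<notin> Tet"
proof -
  have "list_all (\<lambda>p. zneg p \<notin> set (take 4 VL)) (take 4 VL)" by code_simp
  moreover assume "x \<in> Tet"
  then obtain p where p: "p \<in> set (take 4 VL)" "x = ev p" by (auto simp: Tet_def)
  ultimately have "zneg p \<notin> set (take 4 VL)" "p \<in> set VL"
    by (auto simp: list_all_iff dest: in_set_takeD)
  then show "- x \<notin> Tet"
    using ev_image_iff[of "zneg p" "take 4 VL"] zneg_VL
    by (simp add: Tet_def p(2) ev_zneg[symmetric] set_take_subset)
qed

lemma T0_minus: "T0 (- x) = - T0 x"
  using Tet_disjoint[of x] by (simp add: T0_def)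

definition p0 :: zvec where "p0 = ((1,0),(1,0),(1,0))"
definition q0 :: zvec where "q0 = ((0,0),(-1,1),(0,1))"

lemma p0_q0: "p0 \<in> set VL" "q0 \<in> set VL" "zadj p0 q0"
  by (simp_all add: p0_def q0_def VL_def zadj_def zeval)

lemma AL_cube: "M \<in> set AL \<Longrightarrow> act_cube (mat_of M) k0 = k0"
proof -
  assume M: "M \<in> set AL"
  have "list_all (\<lambda>M. list_all (\<lambda>p. list_ex (\<lambda>q. zmact M p = zdouble q) K0L) K0L) AL"
    by code_simp
  then have "act_cube (mat_of M) k0 \<subseteq> k0"
    using M mat_of_zmact[of M] unfolding list_all_iff list_ex_iff act_cube_def k0_def by blast
  moreover have "mat_of M \<in> Igrp" using M AL_CL_rot(1) zrot_Igrp by (auto simp: list_all_iff)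
  then have "inj_on (\<lambda>v. mat_of M *v v) k0" by (auto simp: inj_on_def Igrp_eq_iff)
  moreover have "finite k0" by (simp add: k0_def)
  ultimately show ?thesis unfolding act_cube_def by (rule endo_inj_surj[rotated])
qed

lemma AL_Igrp: "M \<in> set AL \<Longrightarrow> mat_of M \<in> Igrp"
  using AL_CL_rot(1) zrot_Igrp by (auto simp: list_all_iff)

lemma AL_orbits:
  "list_all (\<lambda>p. list_ex (\<lambda>M.
     if zT0 p = 1 then zmact M p0 = zdouble p
     else if zT0 p = -1 then zmact M p0 = zdouble (zneg p)
     else zmact M p = zdouble (zneg p)) AL) VL"
  by code_simp

text \<open>The stabiliser of the cube is transitive on the vertices with \<open>T0\<close> equal to
  1; oddness gives those with -1. A vertex off the cube can be rotated to its antipode, so an odd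
  invariant function vanishes there.\<close>

lemma invariant_Vert:
  fixes f :: "real^3 \<Rightarrow> int"
  assumes odd: "\<And>x. x \<in> Vert \<Longrightarrow> f (- x) = - f x"
    and inv: "\<And>M x. M \<in> set AL \<Longrightarrow> x \<in> Vert \<Longrightarrow> f (mat_of M *v x) = f x"
    and x: "x \<in> Vert"
  shows "f x = f (ev p0) * T0 x"
proof -
  obtain p where p: "p \<in> set VL" "x = ev p" using x by (auto simp: Vert_eq)
  then obtain M where M: "M \<in> set AL" "if zT0 p = 1 then zmact M p0 = zdouble p
     else if zT0 p = -1 then zmact M p0 = zdouble (zneg p)
     else zmact M p = zdouble (zneg p)"
    using AL_orbits unfolding list_all_iff list_ex_iff by blast
  have f0: "f (mat_of M *v ev p0) = f (ev p0)" using inv[OF M(1)] p0_q0(1) by (simp add: Vert_eq)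
  have fx: "f (mat_of M *v x) = f x" using inv[OF M(1) x] .
  consider "zT0 p = 1" | "zT0 p = -1" | "zT0 p = 0" using zT0_cases by blast
  then show ?thesis
  proof cases
    case 1
    then show ?thesis using M(2) f0 p T0_ev by (simp add: mat_of_zmact)
  next
    case 2
    then have "f (- x) = f (ev p0)" using M(2) f0 p by (simp add: mat_of_zmact ev_zneg)
    then show ?thesis using 2 p T0_ev odd[OF x] by simp
  next
    case 3
    then have "f (- x) = f x" using M(2) fx p by (simp add: mat_of_zmact ev_zneg)
    then show ?thesis using 3 p T0_ev odd[OF x] by simp
  qed
qed

definition dart_check :: "(zvec \<times> zvec) list \<Rightarrow> zvec \<Rightarrow> zvec \<Rightarrow> bool" where
  "dart_check D p q \<longleftrightarrow>
     (if zT0 p = 1 then zT0 q = 0 \<and> (zdouble p, zdouble q) \<in> set D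
      else if zT0 p = -1 then zT0 q = 0 \<and> (zdouble (zneg p), zdouble (zneg q)) \<in> set D
      else if zT0 q = 1 then (zdouble q, zdouble p) \<in> set D
      else if zT0 q = -1 then (zdouble (zneg q), zdouble (zneg p)) \<in> set D
      else list_ex (\<lambda>M. zmact M p = zdouble q \<and> zmact M q = zdouble p) AL)"

text \<open>Coordinates stay doubled, as \<open>zmact\<close> returns them, hence the occurrences of
  \<open>zdouble\<close> in \<open>dart_check\<close>.\<close>

definition base_darts :: "(zvec \<times> zvec) list" where
  "base_darts = map (\<lambda>M. (zmact M p0, zmact M q0)) AL"

definition darts_check :: "(zvec \<times> zvec) list \<Rightarrow> bool" where
  "darts_check D \<longleftrightarrow> list_all (\<lambda>p. list_all (dart_check D p) (filter (zadj p) VL)) VL"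

lemma AL_dart_orbits: "darts_check base_darts"
  by code_simp

text \<open>The oriented edges leaving vertices with \<open>T0\<close> equal to 1 form one orbit.
  Reversal and the antipodal map reduce every edge that meets the cube to this orbit; any other edge
  is reversed by a rotation of the stabiliser, which forces the value 0.\<close>

lemma invariant_darts:
  fixes f :: "real^3 \<Rightarrow> real^3 \<Rightarrow> int"
  assumes flip: "\<And>a b. dadj a b \<Longrightarrow> f b a = - f a b"
    and odd: "\<And>a b. dadj a b \<Longrightarrow> f (- a) (- b) = - f a b"
    and inv: "\<And>M a b. M \<in> set AL \<Longrightarrow> dadj a b \<Longrightarrow> f (mat_of M *v a) (mat_of M *v b) = f a b"
    and ab: "dadj a b"
  shows "f a b = f (ev p0) (ev q0) * (T0 a - T0 b)"
proof -
  obtain p q where p: "p \<in> set VL" "a = ev p" and q: "q \<in> set VL" "b = ev q"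
    using ab by (auto simp: dadj_iff Vert_eq)
  then have "zadj p q" using ab dadj_ev by blast
  then have c: "dart_check base_darts p q"
    using AL_dart_orbits p(1) q(1) unfolding darts_check_def list_all_iff set_filter by blast
  have base: "f (ev p') (ev q') = f (ev p0) (ev q0)"
    if "(zdouble p', zdouble q') \<in> set base_darts" for p' q'
  proof -
    obtain M where M: "M \<in> set AL" "zmact M p0 = zdouble p'" "zmact M q0 = zdouble q'"
      using \<open>(zdouble p', zdouble q') \<in> set base_darts\<close> by (auto simp: base_darts_def)
    have "f (mat_of M *v ev p0) (mat_of M *v ev q0) = f (ev p0) (ev q0)"
      using inv[OF M(1)] p0_q0 dadj_ev by blast
    then show ?thesis using M by (simp add: mat_of_zmact)
  qed
  have ba: "dadj b a" using ab dadj_sym by blast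
  have T: "T0 a = zT0 p" "T0 b = zT0 q" using T0_ev p q by simp_all
  consider "zT0 p = 1" | "zT0 p = -1" | "zT0 p = 0" "zT0 q = 1" | "zT0 p = 0" "zT0 q = -1"
    | "zT0 p = 0" "zT0 q = 0"
    using zT0_cases[of p] zT0_cases[of q] by blast
  then show ?thesis
  proof cases
    case 1
    then show ?thesis using c base[of p q] p q by (simp add: dart_check_def T0_ev)
  next
    case 2
    then have "f (- a) (- b) = f (ev p0) (ev q0)" "zT0 q = 0"
      using c base[of "zneg p" "zneg q"] p q by (simp_all add: dart_check_def ev_zneg)
    then show ?thesis using 2 odd[OF ab] by (simp add: T)
  next
    case 3
    then have "f b a = f (ev p0) (ev q0)" using c base[of q p] p q by (simp add: dart_check_def)
    then show ?thesis using 3 flip[OF ab] by (simp add: T)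
  next
    case 4
    then have "f (- b) (- a) = f (ev p0) (ev q0)"
      using c base[of "zneg q" "zneg p"] p q by (simp add: dart_check_def ev_zneg)
    then show ?thesis using 4 flip[OF ab] odd[OF ba] by (simp add: T)
  next
    case 5
    then have "list_ex (\<lambda>M. zmact M p = zdouble q \<and> zmact M q = zdouble p) AL"
      using c by (simp add: dart_check_def)
    then obtain M where M: "M \<in> set AL" "zmact M p = zdouble q" "zmact M q = zdouble p"
      unfolding list_ex_iff by blast
    then have "f b a = f a b" using inv[OF M(1) ab] p q by (simp add: mat_of_zmact)
    then show ?thesis using 5 flip[OF ab] by (simp add: T)
  qed
qed

text \<open>The sum of the paths \<open>(s\<^sub>1, s\<^sub>2, s\<^sub>3), (s\<^sub>1/\<phi>, s\<^sub>2\<phi>, 0), (s\<^sub>1, s\<^sub>2, -s\<^sub>3)\<close> with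
  \<open>s\<^sub>1s\<^sub>2s\<^sub>3 = 1\<close>. It is not invariant under the rotations of order 3 preserving the cube, and no
  invariant chain would do, because its pairing with \<open>\<delta>\<^sub>x\<close> at a cube vertex \<open>x\<close> would be divisible by 3.\<close>
fun trc_chain :: "cell1 \<Rightarrow> int" where
  "trc_chain (Ed x a) = (if dadj x a then (if a $ 3 = 0 then T0 x else 0) - (if x $ 3 = 0 then T0 a else 0)
     else 0)"
| "trc_chain (Ar x a b) = 0"

lemma trc_chain1: "chain1 trc_chain"
  unfolding chain1_def
proof (intro conjI allI impI)
  show "trc_chain \<sigma> = 0" if "\<sigma> \<notin> cells1" for \<sigma>
    using that by (cases \<sigma>) (auto simp: cells1_def)
  show "trc_chain (rev1 \<sigma>) = - trc_chain \<sigma>" for \<sigma> by (cases \<sigma>) (auto simp: dadj_sym)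
qed

text \<open>All arc coefficients are 0, and since \<open>T0\<close> is odd the coefficients on
  antipodal edges cancel.\<close>

lemma trc_chain_cycle: "sigma_cycle trc_chain"
  unfolding sigma_cycle_iff by (simp add: trc_chain1 arc_val_def dadj_minus T0_minus)

lemma int_edge_trc_chain: "dadj a b \<Longrightarrow> int_edge trc_chain (a, b) = 0"
  by (simp add: int_edge_def)

text \<open>Makes the test for a vanishing third coordinate in \<open>trc_chain\<close> decidable on
  pairs.\<close>

lemma VL_third:
  "list_all (\<lambda>(x, y, z). z = (0,0) \<or> zpos z \<or> zpos (zsub (0,0) z)) VL"
  by code_simp

lemma third_ev:
  assumes "p \<in> set VL"
  shows "ev p $ 3 = 0 \<longleftrightarrow> snd (snd p) = (0,0)"
proof -
  obtain x y z where p: "p = (x, y, z)" by (cases p)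
  then have "z = (0,0) \<or> zpos z \<or> zpos (zsub (0,0) z)"
    using VL_third assms unfolding list_all_iff by fastforce
  then show ?thesis by (auto simp: p ev_nth zpos_iff zv_simps zv_consts)
qed

definition ztrc :: "zvec \<Rightarrow> zvec \<Rightarrow> int" where
  "ztrc p q = (if snd (snd q) = (0,0) then zT0 p else 0) - (if snd (snd p) = (0,0) then zT0 q else 0)"

text \<open>A cube vertex has exactly one neighbour with third coordinate 0. A vertex with third
  coordinate 0 has two neighbours on the cube, and their values of \<open>T0\<close> cancel.\<close>

lemma VL_trc: "list_all (\<lambda>p. sum_list (map (ztrc p) (filter (zadj p) VL)) = zT0 p) VL"
  by code_simp

lemma int_trc_trc_chain:
  assumes "x \<in> Vert"
  shows "int_trc trc_chain x = T0 x"
proof -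
  obtain p where p: "p \<in> set VL" "x = ev p" using assms by (auto simp: Vert_eq)
  let ?ps = "filter (zadj p) VL"
  have "inj_on ev (set ?ps)" using inj_ev by (rule inj_on_subset) auto
  then have "int_trc trc_chain x = (\<Sum>q\<in>set ?ps. trc_chain (Ed (ev p) (ev q)))"
    unfolding int_trc_def p(2) nbrs_ev[OF p(1)] by (simp add: sum.reindex)
  also have "\<dots> = (\<Sum>q\<in>set ?ps. ztrc p q)"
  proof (rule sum.cong[OF refl])
    fix q assume "q \<in> set ?ps"
    then have "q \<in> set VL" "zadj p q" by simp_all
    then show "trc_chain (Ed (ev p) (ev q)) = ztrc p q"
      using p(1) dadj_ev[OF p(1), of q] T0_ev[of p] T0_ev[of q] third_ev[of p] third_ev[of q]
      by (simp add: ztrc_def)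
  qed
  also have "\<dots> = sum_list (map (ztrc p) ?ps)"
    using distinct_VL by (simp add: sum_list_distinct_conv_sum_set)
  also have "\<dots> = T0 x" using VL_trc p T0_ev by (simp add: list_all_iff)
  finally show ?thesis .
qed

section \<open>The cycle that pairs with the edge loops\<close>

definition edge_chain :: "cell1 \<Rightarrow> int" where
  "edge_chain \<sigma> = - (\<Sum>x\<in>Tet. delta_trc x \<sigma>)"

lemma finite_Tet: "finite Tet"
  by (simp add: Tet_def)

lemma edge_chain_Ed: "edge_chain (Ed x a) = 0"
  by (simp add: edge_chain_def)

lemma edge_chain_Ar:
  "edge_chain (Ar x a b) = (if x \<in> Tet \<and> dadj x a \<and> dadj x b \<and> a \<noteq> b then if ccw x a b then -1 else 1 else 0)"
proof -
  define w :: int where "w = (if dadj x a \<and> dadj x b \<and> a \<noteq> b then if ccw x a b then 1 else -1 else 0)"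
  have "delta_trc y (Ar x a b) = (if x = y then w else 0)" for y by (simp add: w_def)
  then have "edge_chain (Ar x a b) = - (if x \<in> Tet then w else 0)"
    by (simp add: edge_chain_def finite_Tet)
  then show ?thesis by (simp add: w_def)
qed

lemma ccw_total:
  assumes "dadj x a" "dadj x b" "a \<noteq> b"
  shows "ccw x b a \<longleftrightarrow> \<not> ccw x a b"
proof -
  have "b = nx x a \<or> b = nx x (nx x a)" using nbrs_other(1)[OF assms(1)] assms by blast
  moreover have "a = nx x (nx x (nx x a))" using nx_props(2)[OF assms(1)] by simp
  ultimately show ?thesis
    using nx_props(3)[OF assms(1,2)] nx_props(3)[OF assms(2,1)] ccw_asym by metis
qed

lemma edge_chain1: "chain1 edge_chain"
  unfolding chain1_def
proof (intro conjI allI impI)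
  show "edge_chain \<sigma> = 0" if "\<sigma> \<notin> cells1" for \<sigma>
    using that by (cases \<sigma>) (auto simp: cells1_def edge_chain_Ed edge_chain_Ar)
  show "edge_chain (rev1 \<sigma>) = - edge_chain \<sigma>" for \<sigma>
  proof (cases \<sigma>)
    case (Ar x a b)
    then show ?thesis using ccw_total[of x a b] by (auto simp: edge_chain_Ar)
  qed (simp add: edge_chain_Ed)
qed

text \<open>The value is the same for all three arcs at \<open>x\<close>. This gives the cycle
  condition and turns \<open>int_edge\<close> into a difference of values of
  \<open>T0\<close>.\<close>

lemma arc_val_edge_chain:
  assumes "dadj x a"
  shows "arc_val edge_chain x a = - T0 x"
proof -
  note nx = nx_props[OF assms]
  have "ccw x a (nx x a)" using nx(3,7) by blast
  then show ?thesis
    using nx(4,7) assms Tet_disjoint[of x]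
    by (auto simp: arc_val_def edge_chain_Ar dadj_minus ccw_minus T0_def)
qed

lemma edge_chain_cycle: "sigma_cycle edge_chain"
  unfolding sigma_cycle_iff
  by (simp add: edge_chain1 arc_val_edge_chain edge_chain_Ed nx_props(8))

lemma int_edge_edge_chain:
  assumes "dadj a b"
  shows "int_edge edge_chain (a, b) = T0 a - T0 b"
proof -
  have "dadj b a" using assms dadj_sym by blast
  then show ?thesis
    unfolding int_edge_arc_val[OF edge_chain1 assms]
    by (simp add: arc_val_edge_chain assms nx_props(8))
qed

lemma int_trc_edge_chain: "int_trc edge_chain x = 0"
  by (simp add: int_trc_def edge_chain_Ed)

section \<open>Transport to all cubes and surjectivity for both lattices\<close>

definition cube_rot :: "(real^3) set \<Rightarrow> real^3^3" where
  "cube_rot k = (SOME g. g \<in> Igrp \<and> k = act_cube g k0)"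

lemma cube_rot:
  assumes "k \<in> Cubes"
  shows "cube_rot k \<in> Igrp" "act_cube (cube_rot k) k0 = k"
proof -
  have "\<exists>g. g \<in> Igrp \<and> k = act_cube g k0" using cube_transitive[OF assms] by blast
  from someI_ex[OF this] show "cube_rot k \<in> Igrp" "act_cube (cube_rot k) k0 = k"
    unfolding cube_rot_def by simp_all
qed

lemma finite_oedges: "finite oedges"
  by (rule finite_subset[of _ "Vert \<times> Vert"]) (auto simp: oedges_def dadj_iff finite_Vert)

lemma Ldual_pair:
  assumes f: "is_Ldual Idx \<delta> f" and fin: "finite Idx" and ij: "i \<in> Idx" "j \<in> Idx"
    and null: "sigma_null (\<lambda>\<sigma>. \<delta> i \<sigma> + \<delta> j \<sigma>)"
  shows "f i + f j = (0 :: int)"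
proof -
  \<comment> \<open>Adding two indicators also covers i = j, where the coefficient has to be
    2.\<close>
  define m :: "'a \<Rightarrow> int" where "m l = (if l = i then 1 else 0) + (if l = j then 1 else 0)" for l
  have m: "(\<Sum>l\<in>Idx. m l * h l) = h i + h j" for h
  proof -
    have "m l * h l = (if l = i then h l else 0) + (if l = j then h l else 0)" for l by (simp add: m_def)
    then show ?thesis using fin ij by (simp add: sum.distrib)
  qed
  have "sigma_null (\<lambda>\<sigma>. \<Sum>l\<in>Idx. m l * \<delta> l \<sigma>)" using null by (simp add: m)
  then have "(\<Sum>l\<in>Idx. m l * f l) = 0" using f unfolding is_Ldual_def by blast
  then show ?thesis by (simp add: m)
qed

lemma sigma_null_arcs:
  assumes "\<And>x a. dadj x a \<Longrightarrow> c (Ed x a) = 0" "\<And>\<sigma>. \<sigma> \<in> arcs1 \<Longrightarrow> c \<sigma> + c (antip1 \<sigma>) = 0"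
  shows "sigma_null c"
  unfolding sigma_null_def by (rule exI[of _ "\<lambda>_. 0"]) (simp add: assms)

text \<open>The antipodal map carries the counterclockwise boundary at \<open>x\<close> to the
  clockwise one at \<open>- x\<close>, so after the gluing the two loops are opposite.\<close>

lemma delta_trc_minus:
  assumes "x \<in> Vert"
  shows "sigma_null (\<lambda>\<sigma>. delta_trc x \<sigma> + delta_trc (- x) \<sigma>)"
proof (rule sigma_null_arcs)
  have ne: "- x \<noteq> x"
  proof
    assume "- x = x"
    then have "(- x) \<bullet> x = x \<bullet> x" by (simp only:)
    then show False using inner_Vert_self[OF assms] by simp
  qed
  fix \<sigma> assume "\<sigma> \<in> arcs1"
  then obtain y a b where s: "\<sigma> = Ar y a b" and y: "dadj y a" "dadj y b" "a \<noteq> b"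
    unfolding arcs1_def by blast
  have "delta_trc z (Ar y a b) = (if y = z then if ccw y a b then 1 else -1 else 0)"
    "delta_trc z (Ar (- y) (- a) (- b)) = (if - y = z then if ccw y a b then -1 else 1 else 0)" for z
    using y ccw_total[OF y] by (auto simp: dadj_minus ccw_minus)
  then show "delta_trc x \<sigma> + delta_trc (- x) \<sigma> + (delta_trc x (antip1 \<sigma>) + delta_trc (- x) (antip1 \<sigma>)) = 0"
    using ne by (auto simp: s simp del: delta_trc.simps)
qed simp

text \<open>Reversal and the antipodal map negate the loop already as a chain.\<close>

lemma delta_edge_relations:
  "delta_edge (a, b) \<sigma> + delta_edge (b, a) \<sigma> = 0"
  "delta_edge (a, b) \<sigma> + delta_edge (- a, - b) \<sigma> = 0"
  by (simp_all add: delta_edge_def split del: if_split)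

lemma sigma_null_0: "sigma_null (\<lambda>_. 0)"
  by (rule sigma_null_arcs) simp_all

lemma trc_surj: "phi_star_surj Vert delta_trc (\<lambda>g x. g *v x) int_trc"
  unfolding phi_star_surj_def
proof (intro allI impI)
  fix F :: "(real^3) set \<Rightarrow> real^3 \<Rightarrow> int"
  assume F: "hom_VLd Vert delta_trc (\<lambda>g x. g *v x) F"
  then have dual: "\<And>k. k \<in> Cubes \<Longrightarrow> is_Ldual Vert delta_trc (F k)"
    and sum: "\<And>x. x \<in> Vert \<Longrightarrow> (\<Sum>k\<in>Cubes. F k x) = 0"
    and inv: "\<And>g k x. g \<in> Igrp \<Longrightarrow> k \<in> Cubes \<Longrightarrow> x \<in> Vert \<Longrightarrow> F (act_cube g k) (g *v x) = F k x"
    unfolding hom_VLd_def by blast+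
  \<comment> \<open>At the standard cube the functional is odd because \<open>delta_trc\<close>
    changes sign in homology under the antipodal map, and invariant because the rotations in
    \<open>AL\<close> fix the cube.\<close>
  have F0: "F k0 x = F k0 (ev p0) * T0 x" if "x \<in> Vert" for x
  proof (rule invariant_Vert[OF _ _ that])
    show "F k0 (- y) = - F k0 y" if "y \<in> Vert" for y
      using Ldual_pair[OF dual[OF k0_Cubes] finite_Vert that _ delta_trc_minus[OF that]] that Vert_minus
      by fastforce
    show "F k0 (mat_of M *v y) = F k0 y" if "M \<in> set AL" "y \<in> Vert" for M y
      using inv[OF AL_Igrp[OF that(1)] k0_Cubes that(2)] AL_cube[OF that(1)] by simp
  qed
  \<comment> \<open>The base cycle has pairings \<open>T0\<close>, so this multiple realises
    \<open>F k0\<close>. The choice in \<open>cube_rot\<close> may affect the chain but not its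
    pairings.\<close>
  define u where "u k = act_chain (cube_rot k) (\<lambda>\<sigma>. F k0 (ev p0) * trc_chain \<sigma>)" for k
  have cyc: "sigma_cycle (u k)" if "k \<in> Cubes" for k
    unfolding u_def by (intro sigma_cycle_act sigma_cycle_scale trc_chain_cycle cube_rot that)
  have T: "int_trc (u k) x = F k x" if k: "k \<in> Cubes" and x: "x \<in> Vert" for k x
  proof -
    let ?g = "cube_rot k"
    define x' where "x' = matrix_inv ?g *v x"
    note g = cube_rot[OF k]
    have xx: "x = ?g *v x'" using Igrp_inv(2)[OF g(1)] by (simp add: x'_def)
    then have x': "x' \<in> Vert" using x Igrp_Vert[OF g(1)] by simp
    have "int_trc (u k) x = F k0 x'"
      unfolding u_def xx int_trc_act[OF g(1)] int_trc_linear using F0[OF x'] int_trc_trc_chain[OF x'] by simp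
    also have "\<dots> = F k x" using inv[OF g(1) k0_Cubes x'] g(2) xx by simp
    finally show ?thesis .
  qed
  \<comment> \<open>The criterion needs the pairings with the other lattice as well; they are 0
    because \<open>trc_chain\<close> has no arcs.\<close>
  have E: "int_edge (u k) (a, b) = 0" if k: "k \<in> Cubes" and ab: "dadj a b" for k a b
  proof -
    let ?g = "cube_rot k"
    note g = cube_rot(1)[OF k]
    define a' b' where "a' = matrix_inv ?g *v a" and "b' = matrix_inv ?g *v b"
    have ab': "a = ?g *v a'" "b = ?g *v b'" using Igrp_inv(2)[OF g] by (simp_all add: a'_def b'_def)
    then have d: "dadj a' b'" using ab Igrp_dadj[OF g] by simp
    have "chain1 (\<lambda>\<sigma>. F k0 (ev p0) * trc_chain \<sigma>)"
      using sigma_cycle_scale[OF trc_chain_cycle] by (simp add: sigma_cycle_def)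
    then show ?thesis
      unfolding u_def ab' by (simp add: int_edge_act[OF g _ d] int_edge_linear int_edge_trc_chain[OF d])
  qed
  have "hom_VH u"
    by (rule hom_VH_criterion[where T = F and E = "\<lambda>_ _ _. 0"]) (simp_all add: cyc T E sum inv)
  then show "\<exists>u. hom_VH u \<and> (\<forall>k\<in>Cubes. \<forall>i\<in>Vert. int_trc (u k) i = F k i)" using T by blast
qed

lemma edge_surj: "phi_star_surj oedges delta_edge (\<lambda>g (a, b). (g *v a, g *v b)) int_edge"
  unfolding phi_star_surj_def
proof (intro allI impI)
  fix F :: "(real^3) set \<Rightarrow> (real^3) \<times> (real^3) \<Rightarrow> int"
  assume F: "hom_VLd oedges delta_edge (\<lambda>g (a, b). (g *v a, g *v b)) F"
  have oe: "(a, b) \<in> oedges \<longleftrightarrow> dadj a b" for a b by (simp add: oedges_def)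
  have dual: "\<And>k. k \<in> Cubes \<Longrightarrow> is_Ldual oedges delta_edge (F k)"
    and sum: "\<And>a b. dadj a b \<Longrightarrow> (\<Sum>k\<in>Cubes. F k (a, b)) = 0"
    and inv: "\<And>g k a b. g \<in> Igrp \<Longrightarrow> k \<in> Cubes \<Longrightarrow> dadj a b \<Longrightarrow>
      F (act_cube g k) (g *v a, g *v b) = F k (a, b)"
    using F unfolding hom_VLd_def oe[symmetric] by fastforce+
  have F0: "F k0 (a, b) = F k0 (ev p0, ev q0) * (T0 a - T0 b)" if "dadj a b" for a b
  proof (rule invariant_darts[where f = "\<lambda>a b. F k0 (a, b)", OF _ _ _ that])
    fix a b assume ab: "dadj a b"
    then have e: "(a, b) \<in> oedges" "(b, a) \<in> oedges" "(- a, - b) \<in> oedges"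
      using dadj_sym by (simp_all add: oe dadj_minus)
    show "F k0 (b, a) = - F k0 (a, b)"
      using Ldual_pair[OF dual[OF k0_Cubes] finite_oedges e(1) e(2)] sigma_null_0
      by (simp add: delta_edge_relations)
    show "F k0 (- a, - b) = - F k0 (a, b)"
      using Ldual_pair[OF dual[OF k0_Cubes] finite_oedges e(1) e(3)] sigma_null_0
      by (simp add: delta_edge_relations)
    show "F k0 (mat_of M *v a, mat_of M *v b) = F k0 (a, b)" if "M \<in> set AL" for M
      using inv[OF AL_Igrp[OF that(1)] k0_Cubes ab] AL_cube[OF that(1)] by simp
  qed
  define u where "u k = act_chain (cube_rot k) (\<lambda>\<sigma>. F k0 (ev p0, ev q0) * edge_chain \<sigma>)" for k
  have cyc: "sigma_cycle (u k)" if "k \<in> Cubes" for k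
    unfolding u_def by (intro sigma_cycle_act sigma_cycle_scale edge_chain_cycle cube_rot that)
  \<comment> \<open>\<open>edge_chain\<close> has no edge part, so its pairings with the triangle
    boundaries vanish, also after rotation.\<close>
  have T: "int_trc (u k) x = 0" if k: "k \<in> Cubes" and x: "x \<in> Vert" for k x
  proof -
    let ?g = "cube_rot k"
    note g = cube_rot(1)[OF k]
    have "x = ?g *v (matrix_inv ?g *v x)" using Igrp_inv(2)[OF g] by simp
    then show ?thesis
      unfolding u_def using int_trc_act[OF g] by (metis int_trc_linear(2) int_trc_edge_chain mult_zero_right)
  qed
  have E: "int_edge (u k) (a, b) = F k (a, b)" if k: "k \<in> Cubes" and ab: "dadj a b" for k a b
  proof -
    let ?g = "cube_rot k"
    note g = cube_rot[OF k]
    define a' b' where "a' = matrix_inv ?g *v a" and "b' = matrix_inv ?g *v b"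
    have ab': "a = ?g *v a'" "b = ?g *v b'" using Igrp_inv(2)[OF g(1)] by (simp_all add: a'_def b'_def)
    then have d: "dadj a' b'" using ab Igrp_dadj[OF g(1)] by simp
    have c: "chain1 (\<lambda>\<sigma>. F k0 (ev p0, ev q0) * edge_chain \<sigma>)"
      using sigma_cycle_scale[OF edge_chain_cycle] by (simp add: sigma_cycle_def)
    have "int_edge (u k) (a, b) = F k0 (a', b')"
      unfolding u_def ab' int_edge_act[OF g(1) c d] int_edge_linear int_edge_edge_chain[OF d]
      using F0[OF d] by simp
    also have "\<dots> = F k (a, b)" using inv[OF g(1) k0_Cubes d] g(2) ab' by simp
    finally show ?thesis .
  qed
  have "hom_VH u"
    by (rule hom_VH_criterion[where T = "\<lambda>_ _. 0" and E = "\<lambda>k a b. F k (a, b)"])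
       (simp_all add: cyc T E sum inv)
  moreover have "int_edge (u k) y = F k y" if "k \<in> Cubes" "y \<in> oedges" for k y
    using E[OF that(1)] that(2) by (cases y) (simp add: oe)
  ultimately show "\<exists>u. hom_VH u \<and> (\<forall>k\<in>Cubes. \<forall>i\<in>oedges. int_edge (u k) i = F k i)" by blast
qed

theorem theorem4p4:
  shows "phi_star_surj Vert delta_trc (\<lambda>g x. g *v x) int_trc \<and>
         phi_star_surj oedges delta_edge (\<lambda>g (a, b). (g *v a, g *v b)) int_edge"
  using trc_surj edge_surj by blast

end
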